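(* Let $T\colon X\to X$ be a transitive expanding covering map on a compact metric space $(X,d)$, and let $A\colon X\to\mathbb{R}$ be $\alpha$-Hölder continuous with $\alpha\in(0,1]$. Then the following statements are true: (i) The family $\{\frac1\beta\log u_{\beta A}\}_{\beta\in(1,+\infty)}$ is normal, and the (uniform) limit of every convergent subsequence $\{\frac1{\beta_n}\log u_{\beta_nA}\}_{n\in\mathbb{N}}$ with $\beta_n\to+\infty$ as $n\to+\infty$ is a tropical eigenfunction of $\mathcal{L}_A$. (ii) The family $\{l_\beta^m(\cdot)\}_{\beta\in(1,+\infty)}$ is normal, and the (pointwise) limit of every convergent subsequence $\{l_{\beta_n}^m(\cdot)\}_{n\in\mathbb{N}}$ with $\beta_n\to+\infty$ as $n\to+\infty$ is a tropical linear functional whose density is a tropical eigen-density of $\mathcal{L}_A^{\circledast}$. (iii) The family $\{l_\beta^\mu(\cdot)\}_{\beta\in(1,+\infty)}$ is normal, and the (pointwise) limit of every convergent subsequence $\{l_{\beta_n}^\mu(\cdot)\}_{n\in\mathbb{N}}$ with $\beta_n\to+\infty$ as $n\to+\infty$ is a tropical linear functional whose density is the tropical product of some tropical eigenfunction of $\mathcal{L}_A$ and some tropical eigen-density of $\mathcal{L}_A^{\circledast}$.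
   Context: $T$ is distance-expanding if there exist $\lambda>1$, $\eta>0$ such that $d(x,y)\le2\eta$ implies $d(Tx,Ty)\ge\lambda d(x,y)$. An expanding covering map is an open, continuous, surjective, distance-expanding local homeomorphism $T\colon X\to X$. Transitive means topologically transitive. For $\varphi\in C(X,\mathbb{R})$, $\mathcal{R}_\varphi(u)(x)=\sum_{y\in T^{-1}(x)}u(y)e^{\varphi(y)}$ is the Ruelle operator on $C(X,\mathbb{R})$, with adjoint $\mathcal{R}_\varphi^*$ on measures, and $P(T,\varphi)$ is the topological pressure. For $\beta>0$, $m_{\beta A}$ is the unique Borel probability measure with $\mathcal{R}_{\beta A}^*(m_{\beta A})=e^{P(T,\beta A)}m_{\beta A}$; $u_{\beta A}\in C(X,\mathbb{R})$ is the unique (strictly positive) function with $\mathcal{R}_{\beta A}(u_{\beta A})=e^{P(T,\beta A)}u_{\beta A}$ and $\int u_{\beta A}\,\mathrm{d}m_{\beta A}=1$; $\mu_{\beta A}=u_{\beta A}\cdot m_{\beta A}$ is the unique equilibrium state for $\beta A$. For $f\in C(X,\mathbb{R})$, $l_\beta^\mu(f)=\frac1\beta\log\int e^{\beta f}\,\mathrm{d}\mu_{\beta A}$ and $l_\beta^m(f)=\frac1\beta\log\int e^{\beta f}\,\mathrm{d}m_{\beta A}$. A family of real-valued continuous functions on $X$ (resp. functionals on $C(X,\mathbb{R})$ with the uniform norm) is normal if every sequence in it has a subsequence converging uniformly on every compact subset of $X$ (resp. of $C(X,\mathbb{R})$). Limits of functions on $X$ are uniform; limits of functionals are pointwise. Tropical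 operations: on $\overline{\mathbb{R}}_{\max}=\mathbb{R}\cup\{\pm\infty\}$, $x\oplus y=\max\{x,y\}$, $x\otimes y=x+y$ (with $(-\infty)\otimes(+\infty)=-\infty$), pointwise on functions; the tropical product of $v$ and $b$ is $v\otimes b=v+b$. A functional $l\colon C(X,\mathbb{R})\to\mathbb{R}$ is tropical linear if $l(f\oplus g)=l(f)\oplus l(g)$ and $l(c\otimes f)=c\otimes l(f)$ for all $f,g\in C(X,\mathbb{R})$ and constants $c\in\mathbb{R}$ (it is extended to the constant functions $\pm\infty$ by $l(\pm\infty)=\pm\infty$). Let $D_{\max}(X)=\{b\colon X\to\mathbb{R}\cup\{-\infty\}\text{ upper semi-continuous}\}\cup\{+\infty\}$. The density of $l$ is the (unique) $b\in D_{\max}(X)$ with $l(f)=\sup_{x\in X}(f(x)+b(x))$ for all $f\in C(X,\mathbb{R})$. Bousch operator: $\mathcal{L}_A(u)(x)=\sup_{y\in T^{-1}(x)}\{u(y)+A(y)\}$. Tropical adjoint: $\mathcal{L}_A^{\circledast}(b)(x)=b(T(x))+A(x)$ for $b\in D_{\max}(X)$. A tropical eigenfunction of $\mathcal{L}_A$ is $u\in C(X,\mathbb{R})$ with $\mathcal{L}_A(u)=u\otimes\kappa$ for some $\kappa\in\overline{\mathbb{R}}_{\max}$. A tropical eigen-density of $\mathcal{L}_A^{\circledast}$ is $b\in D_{\max}(X)$, not constantly $+\infty$ or $-\infty$, with $\mathcal{L}_A^{\circledast}(b)=b\otimes\kappa$ for some $\kappa\in\overline{\mathbb{R}}_{\max}$.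 *)

theory Defs
  imports "HOL-Probability.Probability"
begin

text \<open>
  The compact metric space \<open>X\<close> is rendered as a type \<open>'a :: metric_space\<close> whose universe is assumed
  compact, so that \<open>'a \<Rightarrow>\<^sub>C real\<close> with its metric is \<open>C(X, \<real>)\<close> with the uniform norm.
\<close>

definition distance_expanding :: "('a::metric_space \<Rightarrow> 'a) \<Rightarrow> bool" where
  "distance_expanding T \<longleftrightarrow>
     (\<exists>lam>1. \<exists>\<eta>>0. \<forall>x y. dist x y \<le> 2 * \<eta> \<longrightarrow> dist (T x) (T y) \<ge> lam * dist x y)"

definition local_homeomorphism :: "('a::topological_space \<Rightarrow> 'b::topological_space) \<Rightarrow> bool" where
  "local_homeomorphism T \<longleftrightarrow>
     (\<forall>x. \<exists>U. open U \<and> x \<in> U \<and> open (T ` U) \<and> (\<exists>g. homeomorphism U (T ` U) T g))"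

definition expanding_covering_map :: "('a::metric_space \<Rightarrow> 'a) \<Rightarrow> bool" where
  "expanding_covering_map T \<longleftrightarrow>
     open_map euclidean euclidean T \<and> continuous_on UNIV T \<and> surj T \<and>
     distance_expanding T \<and> local_homeomorphism T"

definition topologically_transitive :: "('a::topological_space \<Rightarrow> 'a) \<Rightarrow> bool" where
  "topologically_transitive T \<longleftrightarrow>
     (\<forall>U V. open U \<and> U \<noteq> {} \<and> open V \<and> V \<noteq> {} \<longrightarrow> (\<exists>n. (T ^^ n) ` U \<inter> V \<noteq> {}))"

definition holder_continuous :: "real \<Rightarrow> ('a::metric_space \<Rightarrow> real) \<Rightarrow> bool" where
  "holder_continuous \<alpha> A \<longleftrightarrow> (\<exists>C. \<forall>x y. \<bar>A x - A y\<bar> \<le> C * dist x y powr \<alpha>)"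

definition birkhoff_sum :: "('a \<Rightarrow> 'a) \<Rightarrow> ('a \<Rightarrow> real) \<Rightarrow> nat \<Rightarrow> 'a \<Rightarrow> real" where
  "birkhoff_sum T \<phi> n x = (\<Sum>i<n. \<phi> ((T ^^ i) x))"

text \<open>Separation is with respect to the Bowen metric, the maximum of \<open>dist (T\<^sup>i x) (T\<^sup>i y)\<close> over \<open>i < n\<close>.\<close>

definition separated_set :: "('a::metric_space \<Rightarrow> 'a) \<Rightarrow> nat \<Rightarrow> real \<Rightarrow> 'a set \<Rightarrow> bool" where
  "separated_set T n \<epsilon> E \<longleftrightarrow>
     finite E \<and> (\<forall>x\<in>E. \<forall>y\<in>E. x \<noteq> y \<longrightarrow> (\<exists>i<n. dist ((T ^^ i) x) ((T ^^ i) y) > \<epsilon>))"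

text \<open>The real supremum is harmless: for compact \<open>X\<close> and continuous \<open>T\<close> and \<open>\<phi>\<close> the sums are
  bounded uniformly in the separated set \<open>E\<close>.\<close>

definition separated_partition_function ::
    "('a::metric_space \<Rightarrow> 'a) \<Rightarrow> ('a \<Rightarrow> real) \<Rightarrow> nat \<Rightarrow> real \<Rightarrow> real" where
  "separated_partition_function T \<phi> n \<epsilon> =
     (SUP E\<in>{E. separated_set T n \<epsilon> E}. \<Sum>x\<in>E. exp (birkhoff_sum T \<phi> n x))"

definition topological_pressure :: "('a::metric_space \<Rightarrow> 'a) \<Rightarrow> ('a \<Rightarrow> real) \<Rightarrow> ereal" where
  "topological_pressure T \<phi> =
     Lim (at_right 0)
       (\<lambda>\<epsilon>. limsup (\<lambda>n. ereal (ln (separated_partition_function T \<phi> n \<epsilon>) / real n)))"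

text \<open>The fibres of an expanding covering map of a compact space are finite.\<close>

definition ruelle_operator :: "('a \<Rightarrow> 'a) \<Rightarrow> ('a \<Rightarrow> real) \<Rightarrow> ('a \<Rightarrow> real) \<Rightarrow> 'a \<Rightarrow> real" where
  "ruelle_operator T \<phi> u x = (\<Sum>y\<in>T -` {x}. u y * exp (\<phi> y))"

text \<open>Finite Borel measures are identified with the functionals they induce on \<open>C(X, \<real>)\<close>; the adjoint
  takes a measure to the functional \<open>f \<mapsto> \<integral> \<R>\<^sub>\<phi> f\<close>.\<close>

definition measure_functional :: "'a::topological_space measure \<Rightarrow> ('a \<Rightarrow>\<^sub>C real) \<Rightarrow> real" where
  "measure_functional \<nu> f = (\<integral>x. f x \<partial>\<nu>)"

definition ruelle_adjoint ::
    "('a::topological_space \<Rightarrow> 'a) \<Rightarrow> ('a \<Rightarrow> real) \<Rightarrow> 'a measure \<Rightarrow> ('a \<Rightarrow>\<^sub>C real) \<Rightarrow> real" where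
  "ruelle_adjoint T \<phi> \<nu> f = (\<integral>x. ruelle_operator T \<phi> f x \<partial>\<nu>)"

text \<open>For an expanding covering map of a compact space and continuous \<open>\<phi>\<close> the pressure is finite, so
  \<^const>\<open>real_of_ereal\<close> only changes its type.\<close>

definition ruelle_eigenmeasure ::
    "('a::metric_space \<Rightarrow> 'a) \<Rightarrow> ('a \<Rightarrow> real) \<Rightarrow> 'a measure \<Rightarrow> bool" where
  "ruelle_eigenmeasure T \<phi> m \<longleftrightarrow>
     sets m = sets borel \<and> prob_space m \<and>
     ruelle_adjoint T \<phi> m =
       (\<lambda>f. exp (real_of_ereal (topological_pressure T \<phi>)) * measure_functional m f)"

definition ruelle_eigenfunction ::
    "('a::metric_space \<Rightarrow> 'a) \<Rightarrow> ('a \<Rightarrow> real) \<Rightarrow> 'a measure \<Rightarrow> ('a \<Rightarrow> real) \<Rightarrow> bool" where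
  "ruelle_eigenfunction T \<phi> m u \<longleftrightarrow>
     continuous_on UNIV u \<and> (\<forall>x. u x > 0) \<and>
     ruelle_operator T \<phi> u = (\<lambda>x. exp (real_of_ereal (topological_pressure T \<phi>)) * u x) \<and>
     (\<integral>x. u x \<partial>m) = 1"

definition equilibrium_measure :: "'a measure \<Rightarrow> ('a \<Rightarrow> real) \<Rightarrow> 'a measure" where
  "equilibrium_measure m u = density m (\<lambda>x. ennreal (u x))"

definition log_functional :: "real \<Rightarrow> 'a::topological_space measure \<Rightarrow> ('a \<Rightarrow>\<^sub>C real) \<Rightarrow> real" where
  "log_functional \<beta> \<nu> f = 1 / \<beta> * ln (\<integral>x. exp (\<beta> * f x) \<partial>\<nu>)"

text \<open>Used both on \<open>X\<close> and, with \<open>'b = ('a \<Rightarrow>\<^sub>C real)\<close>, on \<open>C(X, \<real>)\<close>.\<close>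

definition normal_family :: "('b::topological_space \<Rightarrow> real) set \<Rightarrow> bool" where
  "normal_family F \<longleftrightarrow>
     (\<forall>f\<in>F. continuous_on UNIV f) \<and>
     (\<forall>s::nat \<Rightarrow> 'b \<Rightarrow> real. range s \<subseteq> F \<longrightarrow>
        (\<exists>r g. strict_mono r \<and> (\<forall>K. compact K \<longrightarrow> uniform_limit K (\<lambda>n. s (r n)) g sequentially)))"

text \<open>Addition on \<^typ>\<open>ereal\<close> has \<open>-\<infinity> + \<infinity> = \<infinity>\<close>, whereas the tropical product has
  \<open>-\<infinity> \<otimes> \<infinity> = -\<infinity>\<close>.\<close>

definition trop_mult :: "ereal \<Rightarrow> ereal \<Rightarrow> ereal" where
  "trop_mult x y = (if x = -\<infinity> \<or> y = -\<infinity> then -\<infinity> else x + y)"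

definition trop_product :: "('a \<Rightarrow> ereal) \<Rightarrow> ('a \<Rightarrow> ereal) \<Rightarrow> 'a \<Rightarrow> ereal" where
  "trop_product v b = (\<lambda>x. trop_mult (v x) (b x))"

definition trop_sum_bcontfun ::
    "('a::topological_space \<Rightarrow>\<^sub>C real) \<Rightarrow> ('a \<Rightarrow>\<^sub>C real) \<Rightarrow> ('a \<Rightarrow>\<^sub>C real)" where
  "trop_sum_bcontfun f g = Bcontfun (\<lambda>x. max (f x) (g x))"

lemma apply_trop_sum_bcontfun [simp]: "trop_sum_bcontfun f g x = max (f x) (g x)"
proof -
  obtain B where B: "\<And>x. \<bar>f x\<bar> \<le> B"
    using bounded_apply_bcontfun[of f] by (auto simp: bounded_iff)
  obtain C where C: "\<And>x. \<bar>g x\<bar> \<le> C"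
    using bounded_apply_bcontfun[of g] by (auto simp: bounded_iff)
  have "continuous_on UNIV (\<lambda>x. max (f x) (g x))"
    by (intro continuous_on_max) simp_all
  moreover have "norm (max (f x) (g x)) \<le> max B C" for x
    using B[of x] C[of x] by auto
  ultimately have "(\<lambda>x. max (f x) (g x)) \<in> bcontfun"
    by (rule bcontfun_normI)
  then show ?thesis
    by (simp add: trop_sum_bcontfun_def Bcontfun_inverse)
qed

definition tropical_linear :: "(('a::topological_space \<Rightarrow>\<^sub>C real) \<Rightarrow> real) \<Rightarrow> bool" where
  "tropical_linear l \<longleftrightarrow>
     (\<forall>f g. l (trop_sum_bcontfun f g) = max (l f) (l g)) \<and>
     (\<forall>c f. l (const_bcontfun c + f) = c + l f)"

definition upper_semicontinuous :: "('a::topological_space \<Rightarrow> ereal) \<Rightarrow> bool" where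
  "upper_semicontinuous b \<longleftrightarrow> (\<forall>c::real. open {x. b x < ereal c})"

definition D_max :: "('a::topological_space \<Rightarrow> ereal) set" where
  "D_max = {b. (\<forall>x. b x \<noteq> \<infinity>) \<and> upper_semicontinuous b} \<union> {\<lambda>x. \<infinity>}"

definition is_tropical_density ::
    "(('a::topological_space \<Rightarrow>\<^sub>C real) \<Rightarrow> real) \<Rightarrow> ('a \<Rightarrow> ereal) \<Rightarrow> bool" where
  "is_tropical_density l b \<longleftrightarrow>
     b \<in> D_max \<and> (\<forall>f::'a \<Rightarrow>\<^sub>C real. ereal (l f) = (SUP x. trop_mult (ereal (f x)) (b x)))"

definition bousch_operator :: "('a \<Rightarrow> 'a) \<Rightarrow> ('a \<Rightarrow> real) \<Rightarrow> ('a \<Rightarrow> ereal) \<Rightarrow> 'a \<Rightarrow> ereal" where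
  "bousch_operator T A u x = (SUP y\<in>T -` {x}. trop_mult (u y) (ereal (A y)))"

definition tropical_adjoint :: "('a \<Rightarrow> 'a) \<Rightarrow> ('a \<Rightarrow> real) \<Rightarrow> ('a \<Rightarrow> ereal) \<Rightarrow> 'a \<Rightarrow> ereal" where
  "tropical_adjoint T A b x = trop_mult (b (T x)) (ereal (A x))"

definition tropical_eigenfunction ::
    "('a::topological_space \<Rightarrow> 'a) \<Rightarrow> ('a \<Rightarrow> real) \<Rightarrow> ('a \<Rightarrow> real) \<Rightarrow> bool" where
  "tropical_eigenfunction T A u \<longleftrightarrow>
     continuous_on UNIV u \<and>
     (\<exists>\<kappa>::ereal. bousch_operator T A (\<lambda>x. ereal (u x)) = trop_product (\<lambda>x. ereal (u x)) (\<lambda>x. \<kappa>))"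

definition tropical_eigen_density ::
    "('a::topological_space \<Rightarrow> 'a) \<Rightarrow> ('a \<Rightarrow> real) \<Rightarrow> ('a \<Rightarrow> ereal) \<Rightarrow> bool" where
  "tropical_eigen_density T A b \<longleftrightarrow>
     b \<in> D_max \<and> b \<noteq> (\<lambda>x. \<infinity>) \<and> b \<noteq> (\<lambda>x. -\<infinity>) \<and>
     (\<exists>\<kappa>::ereal. tropical_adjoint T A b = trop_product b (\<lambda>x. \<kappa>))"

end

theory Submission
  imports Defs "HOL-Complex_Analysis.Great_Picard"
begin

text \<open>
  Put \<open>v\<^sub>\<beta> = ln u\<^sub>\<beta> / \<beta>\<close> and \<open>p\<^sub>\<beta> = P(T, \<beta> A) / \<beta>\<close>. In these terms the eigenvalue equation of the Ruelle
  operator reads \<open>(1/\<beta>) ln (\<Sum>y\<in>T\<inverse>x. exp (\<beta> (v\<^sub>\<beta> y + A y))) = v\<^sub>\<beta> x + p\<^sub>\<beta>\<close>. Fibres have at most \<open>N\<close> points, so the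
  left-hand side differs from the Bousch operator \<open>max (v\<^sub>\<beta> y + A y)\<close> by at most \<open>ln N / \<beta>\<close>, and every
  limit of \<open>v\<^sub>\<beta>\<close> as \<open>\<beta> \<rightarrow> \<infinity>\<close> is a tropical eigenfunction, the eigenvalue being a limit of the bounded
  numbers \<open>p\<^sub>\<beta>\<close> (\<open>tropical_eigenfunction_limit\<close>).

  Compactness of the \<open>v\<^sub>\<beta>\<close> has to be uniform in \<open>\<beta>\<close>. The equation compares \<open>v\<^sub>\<beta>\<close> at two nearby points with
  its values on their fibres, which expansion matches by a contracting bijection; iterating the
  comparison gives a Hoelder constant that depends only on \<open>A\<close> and \<open>T\<close> (\<open>scaled_eigen_Holder\<close>). Transitivity
  bounds the oscillation (\<open>scaled_eigen_oscillation\<close>), and the normalisation \<open>\<integral> u\<^sub>\<beta> dm\<^sub>\<beta> = 1\<close> puts \<open>0\<close> in the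
  range of \<open>v\<^sub>\<beta>\<close>.

  The functionals \<open>l\<^sub>\<beta> f = ln (\<integral> exp (\<beta> f) dm\<^sub>\<beta>) / \<beta>\<close> are 1-Lipschitz and \<open>C(X)\<close> is separable, so they form a
  normal family. As \<open>exp (\<beta> max f g)\<close> lies within a factor \<open>2\<close> of \<open>exp (\<beta> f) + exp (\<beta> g)\<close>, a limit \<open>l\<close>
  is tropical linear (\<open>tropical_linear_limit\<close>). Applied to \<open>exp (\<beta> f)\<close>, the
  equation for \<open>m\<^sub>\<beta>\<close> becomes in the limit \<open>l (L\<^sub>A f) = l f + \<kappa>\<close>, where \<open>L\<^sub>A\<close> is the Bousch operator. If \<open>b\<close> is
  the density of \<open>l\<close>, then \<open>l \<circ> L\<^sub>A\<close> has density \<open>b \<circ> T + A\<close> and \<open>l + \<kappa>\<close> has density \<open>b + \<kappa>\<close>; uniqueness of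
  densities makes \<open>b\<close> an eigen-density (\<open>tropical_eigen_densityI\<close>).

  For the equilibrium states \<open>u\<^sub>\<beta> m\<^sub>\<beta>\<close> the functional is \<open>f \<mapsto> l\<^sub>\<beta> (f + v\<^sub>\<beta>)\<close>. Along a subsequence \<open>v\<^sub>\<beta>\<close> and \<open>l\<^sub>\<beta>\<close>
  converge to some \<open>v\<close> and \<open>l'\<close>, so the limit is \<open>l' (f + v)\<close>, with density \<open>v + b\<close> for the density \<open>b\<close>
  of \<open>l'\<close> (\<open>equilibrium_limit_split\<close>).
\<close>

section \<open>Normality from equicontinuity\<close>

lemma compact_finite_net:
  assumes "compact (UNIV::'a::metric_space set)" "e > 0"
  obtains F :: "'a::metric_space set" where "finite F" "\<And>x. \<exists>p\<in>F. dist p x < e"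
proof -
  obtain k where "finite k" "(UNIV::'a set) \<subseteq> (\<Union>x\<in>k. ball x e)"
    using assms unfolding compact_eq_totally_bounded by meson
  then show thesis using that[of k] by (auto simp: subset_iff)
qed

lemma compact_countable_dense:
  assumes "compact (UNIV::'a::metric_space set)"
  obtains S :: "'a::metric_space set" where "countable S" "\<And>x e. e > 0 \<Longrightarrow> \<exists>s\<in>S. dist s x < e"
proof -
  have "\<exists>F::'a set. finite F \<and> (\<forall>x. \<exists>p\<in>F. dist p x < inverse (real (Suc n)))" for n
    by (rule compact_finite_net[OF assms, of "inverse (real (Suc n))"]) auto
  then obtain F :: "nat \<Rightarrow> 'a set" where F: "\<And>n. finite (F n)"
      "\<And>n x. \<exists>p\<in>F n. dist p x < inverse (real (Suc n))"
    by metis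
  show thesis
  proof
    show "countable (\<Union>n. F n)"
      using F(1) by (auto intro: countable_finite)
    fix x :: 'a and e :: real assume "e > 0"
    then obtain n where "inverse (real (Suc n)) < e"
      using reals_Archimedean by blast
    then show "\<exists>s\<in>\<Union>n. F n. dist s x < e"
      using F(2)[of n x] by force
  qed
qed

text \<open>On a separable space the diagonal argument gives pointwise convergence on a countable dense
  set; equicontinuity carries it to all points and makes it uniform on compact sets. Dividing by the
  pointwise bound \<open>M\<close> reduces to a uniformly bounded sequence.\<close>

lemma equicontinuous_convergent_subsequence:
  fixes h :: "nat \<Rightarrow> 'b::metric_space \<Rightarrow> real" and D :: "'b set"
  assumes D: "countable D" "\<And>x e. e > 0 \<Longrightarrow> \<exists>s\<in>D. dist s x < e"
    and M: "\<And>n x. \<bar>h n x\<bar> \<le> M x"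
    and equi: "\<And>e. e > 0 \<Longrightarrow> \<exists>d>0. \<forall>n x y. dist x y < d \<longrightarrow> \<bar>h n x - h n y\<bar> < e"
  obtains r g where "strict_mono (r::nat \<Rightarrow> nat)"
    "\<And>K. compact K \<Longrightarrow> uniform_limit K (\<lambda>n. h (r n)) g sequentially"
proof -
  have M0: "0 \<le> M x" for x
    using M[of 0 x] by linarith
  have bnd: "norm (h n x / (M x + 1)) \<le> 1" for n x
    using M[of n x] M0[of x] by (simp add: divide_simps)
  obtain r where r: "strict_mono (r::nat \<Rightarrow> nat)"
    and conv: "\<And>x. x \<in> D \<Longrightarrow> \<exists>l. (\<lambda>n. h (r n) x / (M x + 1)) \<longlonglongrightarrow> l"
    using function_convergent_subsequence[OF D(1), of "\<lambda>n x. h n x / (M x + 1)" 1] bnd by blast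
  have CauchyD: "Cauchy (\<lambda>n. h (r n) s)" if s: "s \<in> D" for s
  proof -
    obtain l where "(\<lambda>n. h (r n) s / (M s + 1)) \<longlonglongrightarrow> l"
      using conv[OF s] by blast
    from tendsto_mult_right[OF this, of "M s + 1"]
    have "(\<lambda>n. h (r n) s) \<longlonglongrightarrow> l * (M s + 1)"
      using M0[of s] by simp
    then show ?thesis by (rule LIMSEQ_imp_Cauchy)
  qed
  have near: "\<exists>d>0. \<forall>x. \<exists>N. \<forall>m\<ge>N. \<forall>n\<ge>N. \<forall>y. dist x y < d \<longrightarrow> \<bar>h (r m) y - h (r n) y\<bar> < e"
    if e: "e > 0" for e
  proof -
    obtain d where d: "d > 0" "\<And>n x y. dist x y < d \<Longrightarrow> \<bar>h n x - h n y\<bar> < e / 3"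
      using equi[of "e / 3"] e by auto
    have "\<exists>N. \<forall>m\<ge>N. \<forall>n\<ge>N. \<forall>y. dist x y < d / 2 \<longrightarrow> \<bar>h (r m) y - h (r n) y\<bar> < e" for x
    proof -
      obtain s where s: "s \<in> D" "dist s x < d / 2"
        using D(2)[of "d / 2" x] d(1) by auto
      obtain N where N: "\<And>m n. m \<ge> N \<Longrightarrow> n \<ge> N \<Longrightarrow> dist (h (r m) s) (h (r n) s) < e / 3"
        using CauchyD[OF s(1)] e unfolding Cauchy_def by (meson divide_pos_pos zero_less_numeral)
      have "\<bar>h (r m) y - h (r n) y\<bar> < e" if "m \<ge> N" "n \<ge> N" "dist x y < d / 2" for m n y
      proof -
        have "dist s y < d"
          using s(2) that(3) dist_triangle[of s y x] by linarith
        then show ?thesis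
          using N[OF that(1,2)] d(2)[of s y "r m"] d(2)[of s y "r n"]
          by (simp add: dist_real_def abs_if split: if_splits)
      qed
      then show ?thesis by blast
    qed
    then show ?thesis using d(1) by (intro exI[of _ "d / 2"]) auto
  qed
  define g where "g x = lim (\<lambda>n. h (r n) x)" for x
  have g: "(\<lambda>n. h (r n) x) \<longlonglongrightarrow> g x" for x
  proof -
    have "Cauchy (\<lambda>n. h (r n) x)"
      unfolding Cauchy_def dist_real_def
    proof (intro allI impI)
      fix e :: real assume "e > 0"
      then show "\<exists>M. \<forall>m\<ge>M. \<forall>n\<ge>M. \<bar>h (r m) x - h (r n) x\<bar> < e"
        using near[of e] by (metis dist_self)
    qed
    then show ?thesis
      unfolding g_def by (simp add: Cauchy_convergent_iff convergent_LIMSEQ_iff)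
  qed
  have "uniform_limit K (\<lambda>n. h (r n)) g sequentially" if K: "compact K" for K
  proof (rule uniform_limitI)
    fix e :: real assume e: "e > 0"
    obtain d where d: "d > 0"
      "\<And>x. \<exists>N. \<forall>m\<ge>N. \<forall>n\<ge>N. \<forall>y. dist x y < d \<longrightarrow> \<bar>h (r m) y - h (r n) y\<bar> < e / 2"
      using near[of "e / 2"] e by auto
    obtain k where k: "finite k" "K \<subseteq> (\<Union>x\<in>k. ball x d)"
      using K d(1) unfolding compact_eq_totally_bounded by meson
    obtain N where N: "\<And>x m n y. \<lbrakk>m \<ge> N x; n \<ge> N x; dist x y < d\<rbrakk> \<Longrightarrow> \<bar>h (r m) y - h (r n) y\<bar> < e / 2"
      using d(2) by metis
    have "dist (h (r n) y) (g y) < e" if n: "\<forall>x\<in>k. n \<ge> N x" and y: "y \<in> K" for n y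
    proof -
      obtain x where x: "x \<in> k" "dist x y < d"
        using k(2) y by (auto simp: subset_iff)
      have "eventually (\<lambda>m. \<bar>h (r n) y - h (r m) y\<bar> \<le> e / 2) sequentially"
        using eventually_ge_at_top[of "N x"]
        by eventually_elim (use N[of x n] n x in \<open>auto intro!: less_imp_le\<close>)
      moreover have "(\<lambda>m. \<bar>h (r n) y - h (r m) y\<bar>) \<longlonglongrightarrow> \<bar>h (r n) y - g y\<bar>"
        by (intro tendsto_intros g)
      ultimately have "\<bar>h (r n) y - g y\<bar> \<le> e / 2"
        by (metis tendsto_upperbound trivial_limit_sequentially)
      then show ?thesis using e by (simp add: dist_real_def)
    qed
    moreover have "eventually (\<lambda>n. \<forall>x\<in>k. n \<ge> N x) sequentially"
      using k(1) by (simp add: eventually_ball_finite eventually_ge_at_top)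
    ultimately show "\<forall>\<^sub>F n in sequentially. \<forall>x\<in>K. dist (h (r n) x) (g x) < e"
      by (auto elim: eventually_mono)
  qed
  with r show thesis using that by blast
qed

lemma normal_familyI:
  fixes F :: "('b::metric_space \<Rightarrow> real) set" and D :: "'b set"
  assumes D: "countable D" "\<And>x e. e > 0 \<Longrightarrow> \<exists>s\<in>D. dist s x < e"
    and M: "\<And>f x. f \<in> F \<Longrightarrow> \<bar>f x\<bar> \<le> M x"
    and equi: "\<And>e. e > 0 \<Longrightarrow> \<exists>d>0. \<forall>f\<in>F. \<forall>x y. dist x y < d \<longrightarrow> \<bar>f x - f y\<bar> < e"
  shows "normal_family F"
  unfolding normal_family_def
proof (intro conjI ballI allI impI)
  fix f assume f: "f \<in> F"
  show "continuous_on UNIV f"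
    unfolding continuous_on_iff dist_real_def
    by (metis equi f dist_commute)
next
  fix s :: "nat \<Rightarrow> 'b \<Rightarrow> real" assume s: "range s \<subseteq> F"
  have sF: "s n \<in> F" for n using s by auto
  have M': "\<bar>s n x\<bar> \<le> M x" for n x
    using M[OF sF] .
  have equi': "\<exists>d>0. \<forall>n x y. dist x y < d \<longrightarrow> \<bar>s n x - s n y\<bar> < e" if "e > 0" for e
    using equi[OF that] sF by blast
  show "\<exists>r g. strict_mono r \<and> (\<forall>K. compact K \<longrightarrow> uniform_limit K (\<lambda>n. s (r n)) g sequentially)"
    using equicontinuous_convergent_subsequence[OF D M' equi'] by metis
qed

lemma compact_bcontfun:
  fixes f :: "'a::topological_space \<Rightarrow> real"
  assumes "compact (UNIV::'a set)" "continuous_on UNIV f"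
  shows "f \<in> bcontfun"
  using assms compact_continuous_image[of UNIV f] by (auto simp: bcontfun_def intro: compact_imp_bounded)

text \<open>Separability of \<open>C(X)\<close>: a uniformly continuous \<open>f\<close> is approximated by the upper envelope of
  finitely many cones \<open>q - n d(\<cdot>, p)\<close>, with rational heights \<open>q\<close> close to \<open>f p\<close> and apexes \<open>p\<close> in a
  countable dense set. A steep slope \<open>n\<close> keeps the cones with distant apex below \<open>f\<close>; a net of apexes
  finer than \<open>e / n\<close> makes some cone come close to \<open>f\<close> at every point.\<close>

lemma bcontfun_countable_dense:
  assumes cpt: "compact (UNIV::'a::metric_space set)"
  obtains D :: "('a::metric_space \<Rightarrow>\<^sub>C real) set" where "countable D" "\<And>f e. e > 0 \<Longrightarrow> \<exists>g\<in>D. dist g f < e"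
proof -
  obtain S :: "'a set" where S: "countable S" "\<And>x e. e > 0 \<Longrightarrow> \<exists>s\<in>S. dist s x < e"
    using compact_countable_dense[OF cpt] by blast
  define env :: "nat \<Rightarrow> (real \<times> 'a) set \<Rightarrow> 'a \<Rightarrow> real"
    where "env n P x = Max ((\<lambda>(q, p). q - real n * dist x p) ` P)" for n P x
  have env_cont: "continuous_on UNIV (env n P)" if "finite P" "P \<noteq> {}" for n P
    using that
  proof (induction P rule: finite_ne_induct)
    case (singleton z)
    then show ?case by (auto simp: env_def case_prod_beta intro!: continuous_intros)
  next
    case (insert z P)
    have "env n (insert z P) x = max (fst z - real n * dist x (snd z)) (env n P x)" for x
      using insert.hyps by (auto simp: env_def case_prod_beta)
    then show ?case
      using insert.IH by (auto intro!: continuous_intros simp: fun_eq_iff[symmetric] cong: continuous_on_cong)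
  qed
  define D where "D = (\<lambda>(n, P). Bcontfun (env n P)) ` ((UNIV :: nat set) \<times> {P. finite P \<and> P \<subseteq> \<rat> \<times> S})"
  show thesis
  proof
    show "countable D"
      unfolding D_def
      by (intro countable_image countable_SIGMA countable_Collect_finite_subset S countable_rat) auto
    fix f :: "'a \<Rightarrow>\<^sub>C real" and e :: real assume e0: "e > 0"
    define e' where "e' = e / 5"
    have e: "e' > 0" using e0 by (simp add: e'_def)
    define M where "M = norm f"
    have M: "\<bar>f x\<bar> \<le> M" for x
      using norm_bounded[of f x] by (simp add: M_def)
    have "uniformly_continuous_on UNIV f"
      by (rule compact_uniformly_continuous[OF _ cpt]) simp
    then obtain d where d: "d > 0" "\<And>x y. dist x y < d \<Longrightarrow> \<bar>f x - f y\<bar> < e'"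
      using e unfolding uniformly_continuous_on_def dist_real_def by (metis UNIV_I)
    obtain n :: nat where n: "real n * d > 2 * M + e'"
      using reals_Archimedean3[OF d(1)] by blast
    define r where "r = min d (e' / (real n + 1))"
    have r: "r > 0" using d e by (simp add: r_def)
    have nr: "real n * t \<le> e'" if "t < r" "t \<ge> 0" for t
    proof -
      have "t * (real n + 1) \<le> e'"
        using that by (simp add: r_def pos_less_divide_eq less_imp_le)
      then show ?thesis using that by (simp add: algebra_simps)
    qed
    obtain F :: "'a set" where F: "finite F" "\<And>x. \<exists>p\<in>F. dist p x < r / 2"
      using compact_finite_net[OF cpt, of "r / 2"] r by auto
    obtain \<sigma> where \<sigma>: "\<And>p. \<sigma> p \<in> S \<and> dist (\<sigma> p) p < r / 2"
      using S(2)[of "r / 2"] r by (metis half_gt_zero)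
    have "\<exists>q\<in>\<rat>. f p < q \<and> q < f p + e'" for p
      using Rats_dense_in_real[of "f p" "f p + e'"] e by auto
    then obtain q where q: "\<And>p. q p \<in> \<rat> \<and> f p < q p \<and> q p < f p + e'"
      by metis
    define P where "P = (\<lambda>p. (q (\<sigma> p), \<sigma> p)) ` F"
    have P: "finite P" "P \<noteq> {}" "P \<subseteq> \<rat> \<times> S"
      using F q \<sigma> by (auto simp: P_def)
    have net: "\<exists>p\<in>F. dist x (\<sigma> p) < r" for x
    proof -
      obtain p where p: "p \<in> F" "dist p x < r / 2"
        using F(2)[of x] by auto
      have "dist x (\<sigma> p) < r"
        using \<sigma>[of p] p(2) dist_triangle[of x "\<sigma> p" p] by (simp add: dist_commute)
      with p(1) show ?thesis by blast
    qed
    have lower: "f x - 2 * e' \<le> env n P x" for x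
    proof -
      obtain p where p: "p \<in> F" "dist x (\<sigma> p) < r"
        using net by blast
      have "dist x (\<sigma> p) < d" using p(2) by (simp add: r_def)
      then have "f x < f (\<sigma> p) + e'"
        using d(2)[of x "\<sigma> p"] by linarith
      moreover have "f (\<sigma> p) < q (\<sigma> p)" using q by blast
      moreover have "real n * dist x (\<sigma> p) \<le> e'" using nr[OF p(2)] by simp
      ultimately have "f x - 2 * e' \<le> q (\<sigma> p) - real n * dist x (\<sigma> p)"
        by linarith
      also have "\<dots> \<le> env n P x"
        unfolding env_def using p(1) F(1) by (intro Max_ge) (auto simp: P_def)
      finally show ?thesis .
    qed
    have upper: "env n P x \<le> f x + 2 * e'" for x
    proof -
      have "q (\<sigma> p) - real n * dist x (\<sigma> p) \<le> f x + 2 * e'" for p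
      proof (cases "dist x (\<sigma> p) < d")
        case True
        have "0 \<le> real n * dist x (\<sigma> p)" by simp
        then show ?thesis
          using d(2)[OF True] q[of "\<sigma> p"] by linarith
      next
        case False
        then have "real n * d \<le> real n * dist x (\<sigma> p)"
          by (intro mult_left_mono) auto
        then show ?thesis
          using n q[of "\<sigma> p"] M[of x] M[of "\<sigma> p"] e by linarith
      qed
      then show ?thesis
        unfolding env_def using P(1,2) by (subst Max_le_iff) (auto simp: P_def)
    qed
    define g where "g = Bcontfun (env n P)"
    have g: "apply_bcontfun g = env n P"
      unfolding g_def using compact_bcontfun[OF cpt env_cont[OF P(1,2)]] by (simp add: Bcontfun_inverse)
    have "dist g f \<le> 2 * e'"
    proof (rule dist_bound)
      show "dist (g x) (f x) \<le> 2 * e'" for x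
        using lower[of x] upper[of x] by (simp add: dist_real_def g abs_le_iff)
    qed
    then have "dist g f < e" using e by (simp add: e'_def)
    moreover have "g \<in> D"
      using P by (auto simp: D_def g_def)
    ultimately show "\<exists>g\<in>D. dist g f < e" by blast
  qed
qed

section \<open>Fibres of an expanding covering map\<close>

text \<open>What the proof uses of the dynamics: fibres over nearby points are matched by a bijection that
  contracts distances. The matching replaces inverse branches.\<close>

locale contracting_fibres =
  fixes T :: "'a::metric_space \<Rightarrow> 'a" and lam \<xi> :: real and N :: nat
  assumes compact_space: "compact (UNIV :: 'a set)"
    and continuous_map: "continuous_on UNIV T"
    and transitive: "topologically_transitive T"
    and lam_gt_1: "lam > 1"
    and xi_pos: "\<xi> > 0"
    and finite_fibre: "finite (T -` {x})"
    and fibre_nonempty: "T -` {x} \<noteq> {}"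
    and card_fibre: "card (T -` {x}) \<le> N"
    and fibre_matching: "dist x x' \<le> \<xi> \<Longrightarrow>
      \<exists>h. bij_betw h (T -` {x}) (T -` {x'}) \<and> (\<forall>y\<in>T -` {x}. dist y (h y) \<le> dist x x' / lam)"

text \<open>Openness gives around every \<open>w\<close> a ball that \<open>T\<close> maps over a ball about \<open>T w\<close>; compactness makes
  the radii uniform.\<close>

lemma open_map_uniform_lift:
  fixes T :: "'a::metric_space \<Rightarrow> 'a"
  assumes cpt: "compact (UNIV :: 'a set)" and T: "open_map euclidean euclidean T" "continuous_on UNIV T"
    and \<eta>: "\<eta> > 0"
  obtains \<delta> where "\<delta> > 0" "\<And>w x. dist (T w) x < \<delta> \<Longrightarrow> \<exists>y. T y = x \<and> dist w y < \<eta>"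
proof -
  have "\<exists>r s. r > 0 \<and> s > 0 \<and> s \<le> \<eta> / 2 \<and> ball (T w) (2 * r) \<subseteq> T ` ball w (\<eta> / 2) \<and>
          (\<forall>w'. dist w w' < s \<longrightarrow> dist (T w) (T w') < r)" for w
  proof -
    have "open (T ` ball w (\<eta> / 2))"
      using T(1) by (simp add: open_map_def)
    moreover have "T w \<in> T ` ball w (\<eta> / 2)" using \<eta> by simp
    ultimately obtain e where e: "e > 0" "ball (T w) e \<subseteq> T ` ball w (\<eta> / 2)"
      by (meson open_contains_ball)
    obtain s where s: "s > 0" "\<And>w'. dist w' w < s \<Longrightarrow> dist (T w') (T w) < e / 2"
      using T(2) e(1) unfolding continuous_on_iff by (metis UNIV_I half_gt_zero)
    show ?thesis
      using e s \<eta> by (intro exI[of _ "e / 2"] exI[of _ "min s (\<eta> / 2)"]) (auto simp: dist_commute)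
  qed
  then obtain r s where rs: "\<And>w. r w > 0" "\<And>w. s w > 0" "\<And>w. s w \<le> \<eta> / 2"
      "\<And>w. ball (T w) (2 * r w) \<subseteq> T ` ball w (\<eta> / 2)"
      "\<And>w w'. dist w w' < s w \<Longrightarrow> dist (T w) (T w') < r w"
    by metis
  obtain F where F: "finite F" "(UNIV :: 'a set) \<subseteq> (\<Union>w\<in>F. ball w (s w))"
    using compactE_image[OF cpt, of UNIV "\<lambda>w. ball w (s w)"] rs(2) by (auto simp: subset_iff) (metis dist_self)
  have Fne: "F \<noteq> {}" using F(2) by auto
  show thesis
  proof
    show "Min (r ` F) > 0" using F(1) Fne rs(1) by simp
    fix w x assume wx: "dist (T w) x < Min (r ` F)"
    obtain c where c: "c \<in> F" "dist c w < s c"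
      using F(2) by (auto simp: subset_iff)
    have "dist (T w) x < r c"
      using wx c(1) F(1) by (simp add: Fne)
    then have "dist (T c) x < 2 * r c"
      using rs(5)[OF c(2)] dist_triangle[of "T c" x "T w"] by linarith
    then obtain y where y: "x = T y" "dist c y < \<eta> / 2"
      using rs(4)[of c] by (auto simp: subset_iff)
    have "dist w y < \<eta>"
      using y(2) c(2) rs(3)[of c] dist_triangle3[of w y c] by linarith
    with y(1) show "\<exists>y. T y = x \<and> dist w y < \<eta>" by blast
  qed
qed

text \<open>Two points of one fibre have the same image, so expansion keeps them further than \<open>2 \<eta>\<close> apart. This
  bounds the size of a fibre by that of a finite net, and makes the lift of a nearby base point
  injective on the fibre; by symmetry the two fibres have the same size, so the lift is bijective.\<close>

lemma expanding_covering_map_contracting_fibres: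
  fixes T :: "'a::metric_space \<Rightarrow> 'a"
  assumes cpt: "compact (UNIV :: 'a set)" and T: "expanding_covering_map T"
    and trans: "topologically_transitive T"
  obtains lam \<xi> N where "contracting_fibres T lam \<xi> N"
proof -
  have om: "open_map euclidean euclidean T" and cont: "continuous_on UNIV T" and "surj T"
    using T by (auto simp: expanding_covering_map_def)
  obtain lam \<eta> where lam: "lam > 1" and \<eta>: "\<eta> > 0"
    and expand: "\<And>x y. dist x y \<le> 2 * \<eta> \<Longrightarrow> dist (T x) (T y) \<ge> lam * dist x y"
    using T by (auto simp: expanding_covering_map_def distance_expanding_def)
  have sep: "y = y'" if "T y = T y'" "dist y y' \<le> 2 * \<eta>" for y y'
  proof -
    have "lam * dist y y' \<le> 0" using expand[OF that(2)] that(1) by simp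
    then show ?thesis using lam by (simp add: mult_le_0_iff)
  qed
  obtain F :: "'a set" where F: "finite F" "\<And>x. \<exists>p\<in>F. dist p x < \<eta>"
    using compact_finite_net[OF cpt \<eta>] by blast
  then obtain c where c: "\<And>x. c x \<in> F" "\<And>x. dist (c x) x < \<eta>" by metis
  have inj: "inj_on c (T -` {x})" for x
  proof (rule inj_onI)
    fix y y' assume "y \<in> T -` {x}" "y' \<in> T -` {x}" and eq: "c y = c y'"
    then have "T y = T y'" by simp
    moreover have "dist y y' \<le> 2 * \<eta>"
      using c(2)[of y] c(2)[of y'] eq dist_triangle3[of y y' "c y"] by simp
    ultimately show "y = y'" by (rule sep)
  qed
  have img: "c ` (T -` {x}) \<subseteq> F" for x using c(1) by auto
  have fin: "finite (T -` {x})" for x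
    using inj_on_finite[OF inj img F(1)] .
  have card: "card (T -` {x}) \<le> card F" for x
    using card_inj_on_le[OF inj img F(1)] .
  obtain \<delta> where \<delta>: "\<delta> > 0" "\<And>w x. dist (T w) x < \<delta> \<Longrightarrow> \<exists>y. T y = x \<and> dist w y < \<eta>"
    using open_map_uniform_lift[OF cpt om cont \<eta>] by blast
  have lift: "\<exists>h. inj_on h (T -` {x}) \<and> h ` (T -` {x}) \<subseteq> T -` {x'} \<and>
      (\<forall>y\<in>T -` {x}. dist y (h y) \<le> dist x x' / lam)" if d: "dist x x' < \<delta>" for x x'
  proof -
    have "\<forall>y\<in>T -` {x}. \<exists>y'. T y' = x' \<and> dist y y' < \<eta>"
      using \<delta>(2) d by simp
    then obtain h where h: "\<And>y. y \<in> T -` {x} \<Longrightarrow> T (h y) = x'"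
        "\<And>y. y \<in> T -` {x} \<Longrightarrow> dist y (h y) < \<eta>"
      by metis
    have "inj_on h (T -` {x})"
    proof (rule inj_onI)
      fix y y' assume y: "y \<in> T -` {x}" "y' \<in> T -` {x}" and eq: "h y = h y'"
      have "dist y y' \<le> 2 * \<eta>"
        using h(2)[OF y(1)] h(2)[OF y(2)] eq dist_triangle2[of y y' "h y"] by simp
      then show "y = y'" using sep y by simp
    qed
    moreover have "dist y (h y) \<le> dist x x' / lam" if y: "y \<in> T -` {x}" for y
      using expand[of y "h y"] h(1)[OF y] h(2)[OF y] \<eta> lam y by (simp add: field_simps)
    ultimately show ?thesis using h(1) by (intro exI[of _ h]) auto
  qed
  have "contracting_fibres T lam (\<delta> / 2) (card F)"
  proof
    show "dist x x' \<le> \<delta> / 2 \<Longrightarrow> \<exists>h. bij_betw h (T -` {x}) (T -` {x'}) \<and>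
        (\<forall>y\<in>T -` {x}. dist y (h y) \<le> dist x x' / lam)" for x x'
    proof -
      assume "dist x x' \<le> \<delta> / 2"
      then have d: "dist x x' < \<delta>" "dist x' x < \<delta>"
        using \<delta>(1) by (auto simp: dist_commute)
      obtain h where h: "inj_on h (T -` {x})" "h ` (T -` {x}) \<subseteq> T -` {x'}"
          "\<forall>y\<in>T -` {x}. dist y (h y) \<le> dist x x' / lam"
        using lift[OF d(1)] by blast
      obtain h' where h': "inj_on h' (T -` {x'})" "h' ` (T -` {x'}) \<subseteq> T -` {x}"
        using lift[OF d(2)] by blast
      have "card (T -` {x}) = card (T -` {x'})"
        using card_inj_on_le[OF h(1,2) fin] card_inj_on_le[OF h' fin] by (rule antisym)
      then have "h ` (T -` {x}) = T -` {x'}"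
        using h(1,2) fin by (simp add: card_image card_subset_eq)
      with h show ?thesis by (auto simp: bij_betw_def)
    qed
    show "T -` {x} \<noteq> {}" for x using \<open>surj T\<close> by (metis empty_iff surjD vimage_singleton_eq)
  qed (use cpt cont trans lam \<delta>(1) fin card in auto)
  then show thesis using that by blast
qed

context contracting_fibres
begin

lemma N_pos: "N \<ge> 1"
  using card_fibre finite_fibre fibre_nonempty
  by (metis One_nat_def Suc_leI card_gt_0_iff le_trans)

lemma pull_back:
  assumes "dist (T w) x \<le> \<xi>"
  obtains y where "T y = x" "dist w y \<le> dist (T w) x / lam"
proof -
  obtain h where h: "bij_betw h (T -` {T w}) (T -` {x})"
      "\<forall>y\<in>T -` {T w}. dist y (h y) \<le> dist (T w) x / lam"
    using fibre_matching[OF assms] by blast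
  have "h w \<in> T -` {x}" using bij_betwE[OF h(1)] by simp
  then show thesis using that[of "h w"] h(2) by simp
qed

lemma pull_back_iterate:
  assumes "dist ((T ^^ n) w) x \<le> \<xi>"
  shows "\<exists>y. (T ^^ n) y = x \<and> dist w y \<le> dist ((T ^^ n) w) x"
  using assms
proof (induction n arbitrary: x)
  case 0
  then show ?case by auto
next
  case (Suc n)
  obtain z where z: "T z = x" "dist ((T ^^ n) w) z \<le> dist (T ((T ^^ n) w)) x / lam"
    using pull_back[of "(T ^^ n) w" x] Suc.prems by auto
  have "dist (T ((T ^^ n) w)) x / lam \<le> dist (T ((T ^^ n) w)) x"
    using lam_gt_1 by (simp add: divide_le_eq mult_le_cancel_left1)
  then have le: "dist ((T ^^ n) w) z \<le> dist ((T ^^ Suc n) w) x"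
    using z(2) by simp
  then obtain y where "(T ^^ n) y = z" "dist w y \<le> dist ((T ^^ n) w) z"
    using Suc.IH[of z] Suc.prems by auto
  then show ?case using z(1) le by (intro exI[of _ y]) auto
qed

text \<open>Transitivity made uniform: only the finitely many pairs of balls of a net have to be joined by
  orbits, and the end point of an orbit can then be moved to any nearby point by pulling back.\<close>

lemma bounded_transit:
  assumes "\<epsilon> > 0"
  obtains M where "\<And>x x'. \<exists>n\<le>M. \<exists>y. (T ^^ n) y = x \<and> dist y x' < \<epsilon>"
proof -
  (* x is pulled back over a distance below 2 * \<delta>, and passing to x' through the net costs 2 * \<delta> more *)
  define \<delta> where "\<delta> = min \<epsilon> \<xi> / 4"
  have \<delta>: "\<delta> > 0" "4 * \<delta> \<le> \<epsilon>" "4 * \<delta> \<le> \<xi>"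
    using assms xi_pos by (auto simp: \<delta>_def)
  obtain F :: "'a set" where F: "finite F" "\<And>x. \<exists>p\<in>F. dist p x < \<delta>"
    using compact_finite_net[OF compact_space \<delta>(1)] by blast
  have "\<exists>n w. w \<in> ball p \<delta> \<and> (T ^^ n) w \<in> ball q \<delta>" for p q
  proof -
    have "\<exists>n. (T ^^ n) ` ball p \<delta> \<inter> ball q \<delta> \<noteq> {}"
      using transitive \<delta>(1) unfolding topologically_transitive_def by (metis ball_eq_empty not_le open_ball)
    then show ?thesis by blast
  qed
  then obtain n w where nw: "\<And>p q. w p q \<in> ball p \<delta> \<and> (T ^^ n p q) (w p q) \<in> ball q \<delta>"
    by metis
  define M where "M = Max (case_prod n ` (F \<times> F))"
  have "\<exists>k\<le>M. \<exists>y. (T ^^ k) y = x \<and> dist y x' < \<epsilon>" for x x'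
  proof -
    obtain p q where p: "p \<in> F" "dist p x' < \<delta>" and q: "q \<in> F" "dist q x < \<delta>"
      using F(2) by meson
    have w: "dist p (w p q) < \<delta>" "dist q ((T ^^ n p q) (w p q)) < \<delta>"
      using nw[of p q] by auto
    have d: "dist ((T ^^ n p q) (w p q)) x < 2 * \<delta>"
      using w(2) q(2) dist_triangle3[of "(T ^^ n p q) (w p q)" x q] by linarith
    have "dist ((T ^^ n p q) (w p q)) x \<le> \<xi>" using d \<delta> by linarith
    then obtain y where y: "(T ^^ n p q) y = x" "dist (w p q) y \<le> dist ((T ^^ n p q) (w p q)) x"
      using pull_back_iterate by blast
    have "dist y x' < \<epsilon>"
      using y(2) d w(1) p(2) \<delta> dist_triangle3[of y x' "w p q"] dist_triangle3[of "w p q" x' p] by linarith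
    moreover have "n p q \<le> M"
      unfolding M_def using p(1) q(1) F(1) by (intro Max_ge) (auto intro!: rev_image_eqI[of "(p, q)"])
    ultimately show ?thesis using y(1) by blast
  qed
  then show thesis using that by blast
qed

lemma fibre_matching_close:
  assumes g: "continuous_on UNIV (g :: 'a \<Rightarrow> real)" and e: "e > 0"
  obtains d where "d > 0" "\<And>x x'::'a. dist x x' < d \<Longrightarrow>
    \<exists>h. bij_betw h (T -` {x}) (T -` {x'}) \<and> (\<forall>y\<in>T -` {x}. \<bar>g y - g (h y)\<bar> < e)"
proof -
  obtain d where d: "d > 0" "\<And>x y. dist x y < d \<Longrightarrow> \<bar>g x - g y\<bar> < e"
    using compact_uniformly_continuous[OF g compact_space] e
    unfolding uniformly_continuous_on_def dist_real_def by (metis UNIV_I)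
  show thesis
  proof
    show "min d \<xi> > 0" using d(1) xi_pos by simp
    fix x x' :: 'a assume xx: "dist x x' < min d \<xi>"
    then obtain h where h: "bij_betw h (T -` {x}) (T -` {x'})"
        "\<And>y. y \<in> T -` {x} \<Longrightarrow> dist y (h y) \<le> dist x x' / lam"
      using fibre_matching[of x x'] by auto
    have "dist x x' / lam \<le> dist x x'"
      using lam_gt_1 by (simp add: divide_le_eq mult_le_cancel_left1)
    then have "\<bar>g y - g (h y)\<bar> < e" if "y \<in> T -` {x}" for y
      using d(2)[of y "h y"] h(2)[OF that] xx by simp
    with h(1) show "\<exists>h. bij_betw h (T -` {x}) (T -` {x'}) \<and> (\<forall>y\<in>T -` {x}. \<bar>g y - g (h y)\<bar> < e)"
      by blast
  qed
qed

lemma continuous_fibre_sum: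
  assumes g: "continuous_on UNIV (g :: 'a \<Rightarrow> real)"
  shows "continuous_on UNIV (\<lambda>x. \<Sum>y\<in>T -` {x}. g y)"
  unfolding continuous_on_iff
proof (intro ballI allI impI)
  fix x :: 'a and e :: real assume e: "e > 0"
  obtain d where d: "d > 0" "\<And>x x'::'a. dist x x' < d \<Longrightarrow>
      \<exists>h. bij_betw h (T -` {x}) (T -` {x'}) \<and> (\<forall>y\<in>T -` {x}. \<bar>g y - g (h y)\<bar> < e / (real N + 1))"
    using fibre_matching_close[OF g, of "e / (real N + 1)"] e by (metis divide_pos_pos of_nat_0_le_iff add_nonneg_pos zero_less_one)
  show "\<exists>d>0. \<forall>x'\<in>UNIV. dist x' x < d \<longrightarrow> dist (\<Sum>y\<in>T -` {x'}. g y) (\<Sum>y\<in>T -` {x}. g y) < e"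
  proof (intro exI[of _ d] conjI ballI impI d(1))
    fix x' assume "dist x' x < d"
    then obtain h where h: "bij_betw h (T -` {x'}) (T -` {x})"
        "\<And>y. y \<in> T -` {x'} \<Longrightarrow> \<bar>g y - g (h y)\<bar> < e / (real N + 1)"
      using d(2) by blast
    have "\<bar>(\<Sum>y\<in>T -` {x'}. g y) - (\<Sum>y\<in>T -` {x}. g y)\<bar> = \<bar>\<Sum>y\<in>T -` {x'}. g y - g (h y)\<bar>"
      using sum.reindex_bij_betw[OF h(1), of g] by (simp add: sum_subtractf)
    also have "\<dots> \<le> (\<Sum>y\<in>T -` {x'}. \<bar>g y - g (h y)\<bar>)"
      by (rule sum_abs)
    also have "\<dots> \<le> (\<Sum>y\<in>T -` {x'}. e / (real N + 1))"
      by (intro sum_mono less_imp_le h(2))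
    also have "\<dots> = real (card (T -` {x'})) * (e / (real N + 1))"
      by simp
    also have "\<dots> \<le> real N * (e / (real N + 1))"
      using card_fibre e by (intro mult_right_mono) auto
    also have "\<dots> < e" using e by (simp add: field_simps)
    finally show "dist (\<Sum>y\<in>T -` {x'}. g y) (\<Sum>y\<in>T -` {x}. g y) < e"
      by (simp add: dist_real_def)
  qed
qed

lemma continuous_fibre_Max:
  assumes g: "continuous_on UNIV (g :: 'a \<Rightarrow> real)"
  shows "continuous_on UNIV (\<lambda>x. Max (g ` (T -` {x})))"
  unfolding continuous_on_iff
proof (intro ballI allI impI)
  fix x :: 'a and e :: real assume e: "e > 0"
  obtain d where d: "d > 0" "\<And>x x'::'a. dist x x' < d \<Longrightarrow>
      \<exists>h. bij_betw h (T -` {x}) (T -` {x'}) \<and> (\<forall>y\<in>T -` {x}. \<bar>g y - g (h y)\<bar> < e)"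
    using fibre_matching_close[OF g e] by metis
  have le: "Max (g ` (T -` {x})) < Max (g ` (T -` {x'})) + e" if xx: "dist x x' < d" for x x'
  proof -
    obtain h where h: "bij_betw h (T -` {x}) (T -` {x'})"
        "\<And>y. y \<in> T -` {x} \<Longrightarrow> \<bar>g y - g (h y)\<bar> < e"
      using d(2)[OF xx] by blast
    have "g y < Max (g ` (T -` {x'})) + e" if y: "y \<in> T -` {x}" for y
    proof -
      have "h y \<in> T -` {x'}"
        using bij_betwE[OF h(1)] y by blast
      then have "g (h y) \<le> Max (g ` (T -` {x'}))"
        using finite_fibre by simp
      then show ?thesis using h(2)[OF y] by linarith
    qed
    then show ?thesis using finite_fibre fibre_nonempty by simp
  qed
  show "\<exists>d>0. \<forall>x'\<in>UNIV. dist x' x < d \<longrightarrow> dist (Max (g ` (T -` {x'}))) (Max (g ` (T -` {x}))) < e"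
  proof (intro exI[of _ d] conjI ballI impI d(1))
    fix x' assume xx: "dist x' x < d"
    then have "dist x x' < d" by (simp add: dist_commute)
    from le[OF xx] le[OF this]
    show "dist (Max (g ` (T -` {x'}))) (Max (g ` (T -` {x}))) < e"
      by (simp add: dist_real_def abs_less_iff)
  qed
qed

end

section \<open>Uniform estimates for scaled logarithms of eigenfunctions\<close>

lemma sum_exp_Max_bounds:
  fixes g :: "'b \<Rightarrow> real"
  assumes S: "finite S" "S \<noteq> {}" "card S \<le> N" and \<beta>: "\<beta> > 0"
  shows "exp (\<beta> * Max (g ` S)) \<le> (\<Sum>y\<in>S. exp (\<beta> * g y))"
    and "(\<Sum>y\<in>S. exp (\<beta> * g y)) \<le> real N * exp (\<beta> * Max (g ` S))"
proof -
  have "Max (g ` S) \<in> g ` S" using S by simp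
  then obtain y0 where y0: "y0 \<in> S" "Max (g ` S) = g y0" by auto
  show "exp (\<beta> * Max (g ` S)) \<le> (\<Sum>y\<in>S. exp (\<beta> * g y))"
    unfolding y0(2) by (rule member_le_sum[of y0 S "\<lambda>y. exp (\<beta> * g y)"]) (use y0 S in auto)
  have "(\<Sum>y\<in>S. exp (\<beta> * g y)) \<le> (\<Sum>y\<in>S. exp (\<beta> * Max (g ` S)))"
    using S \<beta> by (intro sum_mono) auto
  also have "\<dots> \<le> real N * exp (\<beta> * Max (g ` S))"
    using S by (simp add: mult_right_mono)
  finally show "(\<Sum>y\<in>S. exp (\<beta> * g y)) \<le> real N * exp (\<beta> * Max (g ` S))" .
qed

context contracting_fibres
begin

text \<open>The eigenvalue equation of the Ruelle operator for the potential \<open>\<beta> A\<close>, written in terms of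
  \<open>v = ln u / \<beta>\<close> and \<open>p = P / \<beta>\<close>: a soft-max version of \<open>max (v y + A y) = v x + p\<close>.\<close>

definition scaled_eigen :: "('a \<Rightarrow> real) \<Rightarrow> real \<Rightarrow> ('a \<Rightarrow> real) \<Rightarrow> real \<Rightarrow> bool" where
  "scaled_eigen A \<beta> v p \<longleftrightarrow> continuous_on UNIV v \<and>
     (\<forall>x. (\<Sum>y\<in>T -` {x}. exp (\<beta> * (v y + A y))) = exp (\<beta> * (v x + p)))"

lemma scaled_eigen_ln:
  assumes "ruelle_eigenfunction T (\<lambda>x. \<beta> * A x) m u" and \<beta>: "\<beta> > 0"
  shows "scaled_eigen A \<beta> (\<lambda>x. 1 / \<beta> * ln (u x))
           (real_of_ereal (topological_pressure T (\<lambda>x. \<beta> * A x)) / \<beta>)"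
proof -
  let ?P = "real_of_ereal (topological_pressure T (\<lambda>x. \<beta> * A x))"
  have u: "continuous_on UNIV u" "\<And>x. u x > 0"
    and eq: "ruelle_operator T (\<lambda>x. \<beta> * A x) u = (\<lambda>x. exp ?P * u x)"
    using assms(1) by (auto simp: ruelle_eigenfunction_def)
  have "u x \<noteq> 0" for x using u(2)[of x] by simp
  then have "continuous_on UNIV (\<lambda>x. 1 / \<beta> * ln (u x))"
    by (intro continuous_intros u(1)) auto
  moreover have "exp (\<beta> * (1 / \<beta> * ln (u y) + c)) = u y * exp (\<beta> * c)" for y c
    using \<beta> u(2)[of y] by (simp add: distrib_left exp_add)
  ultimately show ?thesis
    using fun_cong[OF eq] \<beta> by (simp add: scaled_eigen_def ruelle_operator_def mult.commute)
qed

text \<open>The eigenvalue equation is monotone in the values on the fibre, so a termwise comparison of two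
  matched fibres passes to the base points.\<close>

lemma scaled_eigen_matching_le:
  assumes v: "scaled_eigen A \<beta> v p" and \<beta>: "\<beta> > 0"
    and h: "bij_betw h (T -` {x}) (T -` {x'})"
    and le: "\<And>y. y \<in> T -` {x} \<Longrightarrow> v y + A y \<le> v (h y) + A (h y) + t"
  shows "v x \<le> v x' + t"
proof -
  have "exp (\<beta> * (v x + p)) = (\<Sum>y\<in>T -` {x}. exp (\<beta> * (v y + A y)))"
    using v by (simp add: scaled_eigen_def)
  also have "\<dots> \<le> (\<Sum>y\<in>T -` {x}. exp (\<beta> * t) * exp (\<beta> * (v (h y) + A (h y))))"
  proof (rule sum_mono)
    fix y assume "y \<in> T -` {x}"
    then have "\<beta> * (v y + A y) \<le> \<beta> * (v (h y) + A (h y) + t)"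
      using le \<beta> by (intro mult_left_mono) auto
    then show "exp (\<beta> * (v y + A y)) \<le> exp (\<beta> * t) * exp (\<beta> * (v (h y) + A (h y)))"
      by (simp add: algebra_simps flip: exp_add)
  qed
  also have "\<dots> = exp (\<beta> * t) * (\<Sum>y\<in>T -` {x'}. exp (\<beta> * (v y + A y)))"
    using sum.reindex_bij_betw[OF h, of "\<lambda>y. exp (\<beta> * (v y + A y))"]
    by (simp add: sum_distrib_left[symmetric])
  also have "\<dots> = exp (\<beta> * t) * exp (\<beta> * (v x' + p))"
    using v by (simp add: scaled_eigen_def)
  also have "\<dots> = exp (\<beta> * (v x' + t + p))"
    by (simp add: algebra_simps flip: exp_add)
  finally show ?thesis using \<beta> by simp
qed

text \<open>Bootstrapping. If \<open>v\<close> varies by at most \<open>e\<close> at scale \<open>d\<close>, one application of the eigenvalue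
  equation gives a bound at scale \<open>lam d\<close>, at the cost of the variation of \<open>A\<close> over the matched
  fibres. The constant \<open>K\<close> solves \<open>(K + C) / lam\<^sup>\<alpha> = K\<close>, so it is reproduced at every step and is
  independent of \<open>\<beta>\<close>. After finitely many steps the scale \<open>\<xi>\<close> is reached while \<open>e\<close> is still arbitrary.\<close>

lemma scaled_eigen_Holder:
  assumes v: "scaled_eigen A \<beta> v p" and \<beta>: "\<beta> > 0" and \<alpha>: "\<alpha> > 0"
    and A: "\<And>x y. \<bar>A x - A y\<bar> \<le> C * dist x y powr \<alpha>" and C: "C \<ge> 0"
    and d: "dist x x' \<le> \<xi>"
  shows "\<bar>v x - v x'\<bar> \<le> C / (lam powr \<alpha> - 1) * dist x x' powr \<alpha>"
proof -
  define K where "K = C / (lam powr \<alpha> - 1)"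
  have la: "lam powr \<alpha> > 1"
    using lam_gt_1 \<alpha> by simp
  have "K * (lam powr \<alpha> - 1) = C"
    using la by (simp add: K_def)
  then have "K + C = K * lam powr \<alpha>"
    by (simp add: algebra_simps)
  then have K: "K \<ge> 0" "(K + C) / lam powr \<alpha> = K"
    using la C by (auto simp: K_def)
  have step: "v x \<le> v x' + (e + K * dist x x' powr \<alpha>)"
    if e: "\<And>y y'. dist y y' < r \<Longrightarrow> v y - v y' \<le> e"
      and "dist x x' < r * lam ^ n" "dist x x' \<le> \<xi>" for e r n x x'
    using that(2,3)
  proof (induction n arbitrary: x x')
    case 0
    have "v x - v x' \<le> e" using e 0 by simp
    moreover have "0 \<le> K * dist x x' powr \<alpha>" using K by simp
    ultimately show ?case by linarith
  next
    case (Suc n)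
    obtain h where h: "bij_betw h (T -` {x}) (T -` {x'})"
        "\<And>y. y \<in> T -` {x} \<Longrightarrow> dist y (h y) \<le> dist x x' / lam"
      using fibre_matching[OF Suc.prems(2)] by blast
    show ?case
    proof (rule scaled_eigen_matching_le[OF v \<beta> h(1)])
      fix y assume y: "y \<in> T -` {x}"
      have d1: "dist x x' / lam < r * lam ^ n"
        using Suc.prems(1) lam_gt_1 by (simp add: divide_less_eq mult_ac)
      have d2: "dist x x' / lam \<le> dist x x'"
        using lam_gt_1 by (simp add: divide_le_eq mult_le_cancel_left1)
      have "dist y (h y) < r * lam ^ n" "dist y (h y) \<le> \<xi>"
        using h(2)[OF y] d1 d2 Suc.prems(2) by linarith+
      then have "v y \<le> v (h y) + (e + K * dist y (h y) powr \<alpha>)"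
        by (rule Suc.IH)
      moreover have "A y \<le> A (h y) + C * dist y (h y) powr \<alpha>"
        using A[of y "h y"] by linarith
      moreover have "(K + C) * dist y (h y) powr \<alpha> \<le> K * dist x x' powr \<alpha>"
      proof -
        have "(K + C) * dist y (h y) powr \<alpha> \<le> (K + C) * (dist x x' / lam) powr \<alpha>"
          using h(2)[OF y] K(1) C \<alpha> by (intro mult_left_mono powr_mono2) auto
        also have "\<dots> = (K + C) / lam powr \<alpha> * dist x x' powr \<alpha>"
          using lam_gt_1 by (simp add: powr_divide)
        finally show ?thesis unfolding K(2) .
      qed
      ultimately show "v y + A y \<le> v (h y) + A (h y) + (e + K * dist x x' powr \<alpha>)"
        by (simp add: distrib_right)
    qed
  qed
  have le: "v x \<le> v x' + K * dist x x' powr \<alpha>" if d: "dist x x' \<le> \<xi>" for x x'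
  proof (rule field_le_epsilon)
    fix e :: real assume "e > 0"
    moreover have "uniformly_continuous_on UNIV v"
      using v compact_space by (auto simp: scaled_eigen_def intro: compact_uniformly_continuous)
    ultimately obtain r where r: "r > 0" "\<And>y y'. dist y y' < r \<Longrightarrow> \<bar>v y - v y'\<bar> < e"
      unfolding uniformly_continuous_on_def dist_real_def by (metis UNIV_I)
    then have e: "\<And>y y'. dist y y' < r \<Longrightarrow> v y - v y' \<le> e"
      by (meson abs_ge_self le_less_trans less_imp_le)
    obtain n where "dist x x' / r < lam ^ n"
      using real_arch_pow[OF lam_gt_1] by blast
    then have "dist x x' < r * lam ^ n"
      using r(1) by (simp add: divide_less_eq mult.commute)
    from step[OF e this d] show "v x \<le> v x' + K * dist x x' powr \<alpha> + e"
      by (simp add: add_ac)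
  qed
  show ?thesis
    using le[OF d] le[of x' x] d unfolding K_def[symmetric] by (simp add: dist_commute abs_le_iff)
qed

lemma scaled_eigen_step:
  assumes v: "scaled_eigen A \<beta> v p" and \<beta>: "\<beta> > 0"
  shows "v y + A y \<le> v (T y) + p"
proof -
  have "exp (\<beta> * (v y + A y)) \<le> (\<Sum>y\<in>T -` {T y}. exp (\<beta> * (v y + A y)))"
    using finite_fibre by (intro member_le_sum) auto
  then show ?thesis using v \<beta> by (simp add: scaled_eigen_def)
qed

text \<open>At a maximum of \<open>v\<close> the equation bounds \<open>p\<close> above, the size of the fibre costing \<open>ln N\<close>; at a minimum
  a single preimage bounds \<open>p\<close> below.\<close>

lemma scaled_eigen_pressure_bound:
  assumes v: "scaled_eigen A \<beta> v p" and \<beta>: "\<beta> \<ge> 1" and B: "\<And>x. \<bar>A x\<bar> \<le> B"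
  shows "\<bar>p\<bar> \<le> ln (real N) + B"
proof -
  have \<beta>0: "\<beta> > 0" using \<beta> by simp
  have cont: "continuous_on UNIV v" using v by (simp add: scaled_eigen_def)
  obtain a where a: "\<And>x. v x \<le> v a"
    using continuous_attains_sup[OF compact_space _ cont] by auto
  obtain b where b: "\<And>x. v b \<le> v x"
    using continuous_attains_inf[OF compact_space _ cont] by auto
  obtain y where y: "T y = b" using fibre_nonempty[of b] by auto
  have "- B \<le> p"
    using scaled_eigen_step[OF v \<beta>0, of y] b[of y] B[of y] unfolding y by linarith
  moreover have "p \<le> ln (real N) + B"
  proof -
    have M: "Max ((\<lambda>y. v y + A y) ` (T -` {a})) \<le> v a + B"
      using finite_fibre fibre_nonempty a B by (auto intro!: add_mono intro: order_trans[OF abs_ge_self])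
    have "exp (\<beta> * (v a + p)) \<le> real N * exp (\<beta> * Max ((\<lambda>y. v y + A y) ` (T -` {a})))"
      using v sum_exp_Max_bounds(2)[OF finite_fibre fibre_nonempty card_fibre \<beta>0, where g = "\<lambda>y. v y + A y"]
      by (simp add: scaled_eigen_def)
    also have "\<dots> \<le> real N * exp (\<beta> * (v a + B))"
      using M \<beta>0 by (intro mult_left_mono) auto
    also have "\<dots> = exp (ln (real N) + \<beta> * (v a + B))"
      using N_pos by (simp add: exp_add)
    finally have "\<beta> * p \<le> ln (real N) + \<beta> * B" by (simp add: distrib_left)
    also have "\<dots> \<le> \<beta> * ln (real N) + \<beta> * B"
      using \<beta> N_pos by (simp add: mult_le_cancel_right1)
    also have "\<dots> = \<beta> * (ln (real N) + B)" by (simp add: distrib_left)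
    finally show ?thesis using \<beta>0 by simp
  qed
  moreover have "0 \<le> ln (real N)" using N_pos by simp
  ultimately show ?thesis by (simp add: abs_le_iff)
qed

text \<open>Along an orbit \<open>v\<close> drops by a bounded amount per step, and by transitivity a bounded number of
  steps leads from near any \<open>x'\<close> to any \<open>x\<close>.\<close>

lemma scaled_eigen_oscillation:
  assumes \<alpha>: "\<alpha> > 0" and A: "\<And>x y. \<bar>A x - A y\<bar> \<le> C * dist x y powr \<alpha>" and C: "C \<ge> 0"
    and B: "\<And>x. \<bar>A x\<bar> \<le> B"
  obtains R where "\<And>\<beta> v p x x'. \<beta> \<ge> 1 \<Longrightarrow> scaled_eigen A \<beta> v p \<Longrightarrow> v x' - v x \<le> R"
proof -
  obtain M where M: "\<And>x x'. \<exists>n\<le>M. \<exists>y. (T ^^ n) y = x \<and> dist y x' < \<xi>"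
    using bounded_transit[OF xi_pos] by blast
  define K where "K = C / (lam powr \<alpha> - 1)"
  have K: "K \<ge> 0"
    using C gr_one_powr[OF lam_gt_1 \<alpha>] by (simp add: K_def)
  define c where "c = ln (real N) + 2 * B"
  have c: "c \<ge> 0"
    using B[of undefined] N_pos by (simp add: c_def)
  have "v x' - v x \<le> K * \<xi> powr \<alpha> + real M * c"
    if \<beta>: "\<beta> \<ge> 1" and v: "scaled_eigen A \<beta> v p" for \<beta> v p x x'
  proof -
    have \<beta>0: "\<beta> > 0" using \<beta> by simp
    have step: "v y \<le> v (T y) + c" for y
      using scaled_eigen_step[OF v \<beta>0, of y] scaled_eigen_pressure_bound[OF v \<beta> B] B[of y]
      unfolding c_def abs_le_iff by linarith
    have iter: "v y \<le> v ((T ^^ n) y) + real n * c" for n y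
    proof (induction n)
      case (Suc n)
      then show ?case using step[of "(T ^^ n) y"] by (simp add: distrib_right)
    qed simp
    obtain n y where y: "n \<le> M" "(T ^^ n) y = x" "dist y x' < \<xi>"
      using M by blast
    have "\<bar>v y - v x'\<bar> \<le> K * dist y x' powr \<alpha>"
      unfolding K_def using scaled_eigen_Holder[OF v \<beta>0 \<alpha> A C] y(3) by simp
    also have "\<dots> \<le> K * \<xi> powr \<alpha>"
      using y(3) \<alpha> K by (intro mult_left_mono powr_mono2) auto
    finally have "v x' \<le> v y + K * \<xi> powr \<alpha>" by linarith
    moreover have "real n * c \<le> real M * c"
      using y(1) c by (intro mult_right_mono) auto
    ultimately show ?thesis using iter[of y n] y(2) by simp
  qed
  then show thesis using that by blast
qed

lemma scaled_eigen_equicontinuous: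
  assumes \<alpha>: "\<alpha> > 0" and A: "\<And>x y. \<bar>A x - A y\<bar> \<le> C * dist x y powr \<alpha>" and C: "C \<ge> 0"
    and e: "e > 0"
  obtains d where "d > 0"
    "\<And>\<beta> v p x y. \<lbrakk>\<beta> \<ge> 1; scaled_eigen A \<beta> v p; dist x y < d\<rbrakk> \<Longrightarrow> \<bar>v x - v y\<bar> < e"
proof -
  define K where "K = C / (lam powr \<alpha> - 1)"
  have K: "K \<ge> 0"
    using C gr_one_powr[OF lam_gt_1 \<alpha>] by (simp add: K_def)
  (* chosen so that K * d powr \<alpha> < e; the summand 1 covers K = 0 *)
  define d where "d = min \<xi> ((e / (K + 1)) powr (1 / \<alpha>))"
  show thesis
  proof
    show "d > 0" using xi_pos e K by (simp add: d_def)
    fix \<beta> v p and x y :: 'a assume \<beta>: "\<beta> \<ge> 1" and v: "scaled_eigen A \<beta> v p" and xy: "dist x y < d"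
    have "dist x y powr \<alpha> \<le> ((e / (K + 1)) powr (1 / \<alpha>)) powr \<alpha>"
      using xy \<alpha> by (intro powr_mono2) (auto simp: d_def)
    also have "\<dots> = e / (K + 1)"
      using \<alpha> e K by (simp add: powr_powr)
    finally have "K * dist x y powr \<alpha> \<le> K * (e / (K + 1))"
      using K by (rule mult_left_mono)
    also have "\<dots> < e" using K e by (simp add: field_simps)
    finally show "\<bar>v x - v y\<bar> < e"
      using scaled_eigen_Holder[OF v _ \<alpha> A C, of x y] \<beta> xy by (simp add: K_def d_def)
  qed
qed

end

section \<open>Logarithmic integral functionals\<close>

lemma apply_Bcontfun:
  fixes f :: "'a::topological_space \<Rightarrow> real"
  assumes "compact (UNIV::'a set)" "continuous_on UNIV f"
  shows "apply_bcontfun (Bcontfun f) = f"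
  using compact_bcontfun[OF assms] by (rule Bcontfun_inverse)

text \<open>The functionals are monotone and commute with adding constants; these two properties make them
  1-Lipschitz for the uniform norm, whatever the measure and \<open>\<beta> > 0\<close>.\<close>

locale compact_borel_prob = prob_space \<nu> for \<nu> :: "'a::metric_space measure" +
  assumes sets_borel: "sets \<nu> = sets borel"
    and compact_space: "compact (UNIV :: 'a set)"
begin

lemma integrable_continuous:
  fixes g :: "'a \<Rightarrow> real"
  assumes "continuous_on UNIV g"
  shows "integrable \<nu> g"
proof -
  have "bounded (range g)"
    using compact_continuous_image[OF assms compact_space] by (rule compact_imp_bounded)
  then obtain B where "\<And>x. norm (g x) \<le> B"
    by (auto simp: bounded_iff)
  moreover have "g \<in> borel_measurable \<nu>"
    using borel_measurable_continuous_onI[OF assms] measurable_cong_sets[OF sets_borel refl] by blast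
  ultimately show ?thesis by (intro integrable_const_bound[of g B]) auto
qed

lemma integrable_exp_bcontfun:
  fixes f :: "'a \<Rightarrow>\<^sub>C real"
  shows "integrable \<nu> (\<lambda>x. exp (\<beta> * apply_bcontfun f x))"
  by (intro integrable_continuous continuous_intros) simp

lemma integral_exp_pos:
  fixes f :: "'a \<Rightarrow>\<^sub>C real"
  shows "0 < (\<integral>x. exp (\<beta> * apply_bcontfun f x) \<partial>\<nu>)"
proof -
  have "\<bar>\<beta> * f x\<bar> \<le> \<bar>\<beta>\<bar> * norm f" for x
    using norm_bounded[of f x] by (simp add: abs_mult mult_left_mono)
  then have le: "exp (- (\<bar>\<beta>\<bar> * norm f)) \<le> exp (\<beta> * f x)" for x
    by (smt (verit) exp_le_cancel_iff)
  have "0 < exp (- (\<bar>\<beta>\<bar> * norm f))" by simp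
  also have "\<dots> = (\<integral>x. exp (- (\<bar>\<beta>\<bar> * norm f)) \<partial>\<nu>)" by (simp add: prob_space)
  also have "\<dots> \<le> (\<integral>x. exp (\<beta> * f x) \<partial>\<nu>)"
    by (rule integral_mono[OF _ integrable_exp_bcontfun le]) simp
  finally show ?thesis .
qed

lemma exp_log_functional:
  fixes f :: "'a \<Rightarrow>\<^sub>C real"
  assumes "\<beta> > 0"
  shows "exp (\<beta> * log_functional \<beta> \<nu> f) = (\<integral>x. exp (\<beta> * f x) \<partial>\<nu>)"
  using assms integral_exp_pos[of \<beta> f] by (simp add: log_functional_def)

lemma log_functional_le_iff:
  fixes f :: "'a \<Rightarrow>\<^sub>C real"
  assumes "\<beta> > 0"
  shows "log_functional \<beta> \<nu> f \<le> c \<longleftrightarrow> (\<integral>x. exp (\<beta> * f x) \<partial>\<nu>) \<le> exp (\<beta> * c)"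
  using assms unfolding exp_log_functional[OF assms, symmetric] by simp

lemma log_functional_mono:
  fixes f g :: "'a \<Rightarrow>\<^sub>C real"
  assumes \<beta>: "\<beta> > 0" and le: "\<And>x. f x \<le> g x + c"
  shows "log_functional \<beta> \<nu> f \<le> log_functional \<beta> \<nu> g + c"
  unfolding log_functional_le_iff[OF \<beta>]
proof -
  have "exp (\<beta> * f x) \<le> exp (\<beta> * c) * exp (\<beta> * g x)" for x
    using le[of x] \<beta> by (simp flip: exp_add distrib_left add: add.commute)
  then have "(\<integral>x. exp (\<beta> * f x) \<partial>\<nu>) \<le> (\<integral>x. exp (\<beta> * c) * exp (\<beta> * g x) \<partial>\<nu>)"
    by (intro integral_mono integrable_exp_bcontfun integrable_mult_right)
  also have "\<dots> = exp (\<beta> * c) * exp (\<beta> * log_functional \<beta> \<nu> g)"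
    by (simp add: exp_log_functional[OF \<beta>])
  also have "\<dots> = exp (\<beta> * (log_functional \<beta> \<nu> g + c))"
    by (simp add: distrib_left exp_add)
  finally show "(\<integral>x. exp (\<beta> * f x) \<partial>\<nu>) \<le> exp (\<beta> * (log_functional \<beta> \<nu> g + c))" .
qed

lemma log_functional_0: "log_functional \<beta> \<nu> 0 = 0"
  by (simp add: log_functional_def prob_space)

lemma log_functional_add_const:
  fixes f :: "'a \<Rightarrow>\<^sub>C real"
  assumes "\<beta> > 0"
  shows "log_functional \<beta> \<nu> (const_bcontfun c + f) = c + log_functional \<beta> \<nu> f"
  using log_functional_mono[OF assms, of "const_bcontfun c + f" f c]
    log_functional_mono[OF assms, of f "const_bcontfun c + f" "- c"]
  by simp

lemma log_functional_max_le:
  fixes f g :: "'a \<Rightarrow>\<^sub>C real"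
  assumes \<beta>: "\<beta> > 0"
  shows "log_functional \<beta> \<nu> (trop_sum_bcontfun f g)
    \<le> max (log_functional \<beta> \<nu> f) (log_functional \<beta> \<nu> g) + ln 2 / \<beta>"
proof -
  define M where "M = max (log_functional \<beta> \<nu> f) (log_functional \<beta> \<nu> g)"
  have "(\<integral>x. exp (\<beta> * trop_sum_bcontfun f g x) \<partial>\<nu>) \<le> (\<integral>x. exp (\<beta> * f x) + exp (\<beta> * g x) \<partial>\<nu>)"
    by (intro integral_mono integrable_exp_bcontfun Bochner_Integration.integrable_add) (auto simp: max_def)
  also have "\<dots> = exp (\<beta> * log_functional \<beta> \<nu> f) + exp (\<beta> * log_functional \<beta> \<nu> g)"
    by (simp add: exp_log_functional[OF \<beta>] integrable_exp_bcontfun)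
  also have "\<dots> \<le> exp (\<beta> * M) + exp (\<beta> * M)"
    using \<beta> by (intro add_mono) (auto simp: M_def)
  also have "\<dots> = exp (\<beta> * (M + ln 2 / \<beta>))"
    using \<beta> by (simp add: distrib_left exp_add)
  finally show ?thesis unfolding M_def[symmetric] log_functional_le_iff[OF \<beta>] .
qed

lemma log_functional_lipschitz:
  fixes f g :: "'a \<Rightarrow>\<^sub>C real"
  assumes "\<beta> > 0"
  shows "\<bar>log_functional \<beta> \<nu> f - log_functional \<beta> \<nu> g\<bar> \<le> dist f g"
proof -
  have "f x \<le> g x + dist f g" "g x \<le> f x + dist f g" for x
    using dist_bounded[of f x g] by (auto simp: dist_real_def abs_le_iff)
  from log_functional_mono[OF assms this(1)] log_functional_mono[OF assms this(2)]
  show ?thesis by (simp add: abs_le_iff)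
qed

text \<open>A density amounts to a translation of the argument by the scaled logarithm of the density.\<close>

lemma log_functional_density:
  fixes f :: "'a \<Rightarrow>\<^sub>C real"
  assumes \<beta>: "\<beta> > 0" and u: "continuous_on UNIV u" "\<And>x. u x > 0"
  shows "log_functional \<beta> (density \<nu> (\<lambda>x. ennreal (u x))) f
    = log_functional \<beta> \<nu> (f + Bcontfun (\<lambda>x. 1 / \<beta> * ln (u x)))"
proof -
  have "u x \<noteq> 0" for x using u(2)[of x] by simp
  then have "continuous_on UNIV (\<lambda>x. 1 / \<beta> * ln (u x))"
    by (intro continuous_intros u(1)) auto
  define V where "V = Bcontfun (\<lambda>x. 1 / \<beta> * ln (u x))"
  have V: "apply_bcontfun V = (\<lambda>x. 1 / \<beta> * ln (u x))"
    unfolding V_def by (rule apply_Bcontfun[OF compact_space]) fact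
  have [measurable]: "u \<in> borel_measurable \<nu>" "(\<lambda>x. exp (\<beta> * f x)) \<in> borel_measurable \<nu>"
    using integrable_continuous[OF u(1)] integrable_exp_bcontfun by auto
  have "(\<integral>x. exp (\<beta> * f x) \<partial>density \<nu> (\<lambda>x. ennreal (u x))) = (\<integral>x. u x *\<^sub>R exp (\<beta> * f x) \<partial>\<nu>)"
    using u(2) by (intro integral_density) (auto intro: less_imp_le)
  moreover have "exp (\<beta> * (f x + 1 / \<beta> * ln (u x))) = u x *\<^sub>R exp (\<beta> * f x)" for x
    using \<beta> u(2)[of x] by (simp add: distrib_left exp_add)
  ultimately show ?thesis
    unfolding V_def[symmetric] by (simp add: log_functional_def V)
qed

end

context contracting_fibres
begin

text \<open>As the fibres are finite, the supremum is a maximum of reals; so the operator acts on real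
  continuous functions and composes with functionals on \<open>C(X)\<close>.\<close>

definition bousch :: "('a \<Rightarrow> real) \<Rightarrow> ('a \<Rightarrow> real) \<Rightarrow> 'a \<Rightarrow> real" where
  "bousch A f x = Max ((\<lambda>y. f y + A y) ` (T -` {x}))"

lemma continuous_bousch:
  assumes "continuous_on UNIV A" "continuous_on UNIV f"
  shows "continuous_on UNIV (bousch A f)"
  unfolding bousch_def by (intro continuous_fibre_Max continuous_intros assms)

lemma bousch_operator_ereal: "bousch_operator T A (\<lambda>x. ereal (f x)) x = ereal (bousch A f x)"
proof -
  have "bousch_operator T A (\<lambda>x. ereal (f x)) x = (SUP y\<in>T -` {x}. ereal (f y + A y))"
    by (simp add: bousch_operator_def trop_mult_def)
  also have "\<dots> = ereal (bousch A f x)"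
  proof (rule antisym)
    show "(SUP y\<in>T -` {x}. ereal (f y + A y)) \<le> ereal (bousch A f x)"
      using finite_fibre by (intro SUP_least) (auto simp: bousch_def)
    have "bousch A f x \<in> (\<lambda>y. f y + A y) ` (T -` {x})"
      unfolding bousch_def using finite_fibre fibre_nonempty by (intro Max_in) auto
    then show "ereal (bousch A f x) \<le> (SUP y\<in>T -` {x}. ereal (f y + A y))"
      by (auto intro: SUP_upper2)
  qed
  finally show ?thesis .
qed

text \<open>The Ruelle operator applied to \<open>exp (\<beta> f)\<close> is \<open>exp (\<beta> (bousch A f))\<close> up to a factor between \<open>1\<close> and
  \<open>N\<close>; after taking \<open>ln / \<beta>\<close> the factor becomes an error \<open>ln (real N) / \<beta>\<close>.\<close>

lemma scaled_eigen_bousch: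
  assumes v: "scaled_eigen A \<beta> v p" and \<beta>: "\<beta> > 0"
  shows "bousch A v x \<le> v x + p" and "v x + p \<le> bousch A v x + ln (real N) / \<beta>"
proof -
  note b = sum_exp_Max_bounds[OF finite_fibre fibre_nonempty card_fibre \<beta>,
      where g = "\<lambda>y. v y + A y", folded bousch_def]
  have eq: "(\<Sum>y\<in>T -` {x}. exp (\<beta> * (v y + A y))) = exp (\<beta> * (v x + p))"
    using v by (simp add: scaled_eigen_def)
  show "bousch A v x \<le> v x + p"
    using b(1)[of x] \<beta> by (simp add: eq)
  have "exp (\<beta> * (v x + p)) \<le> exp (\<beta> * (bousch A v x + ln (real N) / \<beta>))"
    using b(2)[of x, unfolded eq] \<beta> N_pos by (simp add: distrib_left exp_add mult.commute)
  then show "v x + p \<le> bousch A v x + ln (real N) / \<beta>"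
    using \<beta> by simp
qed

text \<open>The eigenmeasure equation is tested on \<open>exp (\<beta> f)\<close>.\<close>

lemma log_functional_bousch:
  fixes f :: "'a \<Rightarrow>\<^sub>C real"
  assumes m: "ruelle_eigenmeasure T (\<lambda>x. \<beta> * A x) m" and \<beta>: "\<beta> > 0" and A: "continuous_on UNIV A"
  defines "p \<equiv> real_of_ereal (topological_pressure T (\<lambda>x. \<beta> * A x)) / \<beta>"
  shows "log_functional \<beta> m (Bcontfun (bousch A f)) \<le> log_functional \<beta> m f + p"
    and "log_functional \<beta> m f + p \<le> log_functional \<beta> m (Bcontfun (bousch A f)) + ln (real N) / \<beta>"
proof -
  interpret prob_space m using m by (simp add: ruelle_eigenmeasure_def)
  interpret compact_borel_prob m
    using m compact_space by unfold_locales (auto simp: ruelle_eigenmeasure_def)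
  have L: "apply_bcontfun (Bcontfun (bousch A f)) = bousch A f"
    by (intro apply_Bcontfun compact_space continuous_bousch A) simp
  define E where "E = Bcontfun (\<lambda>x. exp (\<beta> * f x))"
  have E: "apply_bcontfun E = (\<lambda>x. exp (\<beta> * f x))"
    unfolding E_def by (intro apply_Bcontfun compact_space continuous_intros) simp
  have R: "ruelle_operator T (\<lambda>x. \<beta> * A x) (\<lambda>x. exp (\<beta> * f x)) = (\<lambda>x. \<Sum>y\<in>T -` {x}. exp (\<beta> * (f y + A y)))"
    by (rule ext) (simp add: ruelle_operator_def distrib_left exp_add)
  have int: "integrable m (\<lambda>x. \<Sum>y\<in>T -` {x}. exp (\<beta> * (f y + A y)))"
    by (intro integrable_continuous continuous_fibre_sum continuous_intros A) simp
  have "ruelle_adjoint T (\<lambda>x. \<beta> * A x) m E = exp (\<beta> * p) * measure_functional m E"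
    using m \<beta> by (simp add: ruelle_eigenmeasure_def p_def)
  then have "(\<integral>x. (\<Sum>y\<in>T -` {x}. exp (\<beta> * (f y + A y))) \<partial>m) = exp (\<beta> * p) * (\<integral>x. exp (\<beta> * f x) \<partial>m)"
    unfolding ruelle_adjoint_def measure_functional_def E R .
  also have "\<dots> = exp (\<beta> * (log_functional \<beta> m f + p))"
    by (simp add: exp_log_functional[OF \<beta>, symmetric] distrib_left exp_add)
  finally have eq: "(\<integral>x. (\<Sum>y\<in>T -` {x}. exp (\<beta> * (f y + A y))) \<partial>m) = exp (\<beta> * (log_functional \<beta> m f + p))" .
  note b = sum_exp_Max_bounds[OF finite_fibre fibre_nonempty card_fibre \<beta>,
      where g = "\<lambda>y. f y + A y", folded bousch_def]
  note intL = integrable_exp_bcontfun[of \<beta> "Bcontfun (bousch A f)", unfolded L]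
  have "(\<integral>x. exp (\<beta> * bousch A f x) \<partial>m) \<le> exp (\<beta> * (log_functional \<beta> m f + p))"
    unfolding eq[symmetric] by (intro integral_mono int intL b)
  then show "log_functional \<beta> m (Bcontfun (bousch A f)) \<le> log_functional \<beta> m f + p"
    by (simp add: log_functional_le_iff[OF \<beta>] L)
  have "exp (\<beta> * (log_functional \<beta> m f + p)) \<le> (\<integral>x. real N * exp (\<beta> * bousch A f x) \<partial>m)"
    unfolding eq[symmetric] by (intro integral_mono int intL b integrable_mult_right)
  also have "\<dots> = real N * exp (\<beta> * log_functional \<beta> m (Bcontfun (bousch A f)))"
    by (simp add: exp_log_functional[OF \<beta>] L)
  also have "\<dots> = exp (\<beta> * (log_functional \<beta> m (Bcontfun (bousch A f)) + ln (real N) / \<beta>))"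
    using \<beta> N_pos by (simp add: distrib_left exp_add)
  finally show "log_functional \<beta> m f + p \<le> log_functional \<beta> m (Bcontfun (bousch A f)) + ln (real N) / \<beta>"
    using \<beta> by simp
qed

end

section \<open>Densities of tropical linear functionals\<close>

lemma trop_mult_ereal_left: "trop_mult (ereal r) b = ereal r + b"
  by (cases b) (auto simp: trop_mult_def)

lemma trop_mult_ereal_right: "trop_mult b (ereal r) = b + ereal r"
  by (cases b) (auto simp: trop_mult_def)

lemma is_tropical_density_iff:
  "is_tropical_density l b \<longleftrightarrow> b \<in> D_max \<and> (\<forall>f. ereal (l f) = (SUP x. ereal (apply_bcontfun f x) + b x))"
  by (simp add: is_tropical_density_def trop_mult_ereal_left)

lemma is_tropical_density_upper:
  fixes f :: "'a::topological_space \<Rightarrow>\<^sub>C real"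
  assumes "is_tropical_density l b"
  shows "ereal (f x) + b x \<le> ereal (l f)"
  using assms by (auto simp: is_tropical_density_iff intro: SUP_upper)

lemma is_tropical_density_least:
  fixes f :: "'a::topological_space \<Rightarrow>\<^sub>C real"
  assumes "is_tropical_density l b" "\<And>x. ereal (f x) + b x \<le> ereal c"
  shows "l f \<le> c"
proof -
  have "ereal (l f) = (SUP x. ereal (f x) + b x)"
    using assms(1) by (simp add: is_tropical_density_iff)
  also have "\<dots> \<le> ereal c" by (rule SUP_least) (rule assms(2))
  finally show ?thesis by simp
qed

lemma is_tropical_density_nontrivial:
  fixes l :: "('a::topological_space \<Rightarrow>\<^sub>C real) \<Rightarrow> real"
  assumes "is_tropical_density l b"
  shows "b x \<noteq> \<infinity>" "b \<noteq> (\<lambda>x. \<infinity>)" "b \<noteq> (\<lambda>x. -\<infinity>)"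
proof -
  show "b x \<noteq> \<infinity>"
    using is_tropical_density_upper[OF assms, of 0 x] by auto
  then show "b \<noteq> (\<lambda>x. \<infinity>)" by auto
  show "b \<noteq> (\<lambda>x. -\<infinity>)"
  proof
    assume "b = (\<lambda>x. -\<infinity>)"
    then have "ereal (l 0) = (SUP x::'a. -\<infinity>)"
      using assms by (simp add: is_tropical_density_iff)
    then show False by simp
  qed
qed

text \<open>A tropical linear functional determines its density as a conjugate: upper semi-continuity confines
  \<open>{y. b y \<ge> c}\<close> to the complement of a ball about \<open>x\<close> once \<open>c > b x\<close>, so a steep cone \<open>f\<close> with apex \<open>x\<close>
  picks up at most \<open>c\<close>.\<close>

lemma is_tropical_density_conjugate:
  assumes cpt: "compact (UNIV :: 'a::metric_space set)"
    and b: "is_tropical_density l (b :: 'a \<Rightarrow> ereal)"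
  shows "b x = (INF f. ereal (l f - apply_bcontfun f x))"
proof (rule antisym)
  show "b x \<le> (INF f. ereal (l f - apply_bcontfun f x))"
  proof (rule INF_greatest)
    fix f :: "'a \<Rightarrow>\<^sub>C real"
    show "b x \<le> ereal (l f - f x)"
      using is_tropical_density_upper[OF b, of f x] by (cases "b x") auto
  qed
  show "(INF f. ereal (l f - apply_bcontfun f x)) \<le> b x"
  proof (rule ccontr)
    assume "\<not> ?thesis"
    then have "b x < (INF f. ereal (l f - apply_bcontfun f x))" by simp
    from ereal_dense2[OF this]
    obtain c where c: "b x < ereal c" "ereal c < (INF f. ereal (l f - apply_bcontfun f x))"
      by blast
    have "open {y. b y < ereal c}"
      using b is_tropical_density_nontrivial(2)[OF b]
      by (auto simp: is_tropical_density_def D_max_def upper_semicontinuous_def)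
    moreover have "x \<in> {y. b y < ereal c}" using c(1) by simp
    ultimately obtain r where r: "r > 0" "ball x r \<subseteq> {y. b y < ereal c}"
      by (meson open_contains_ball)
    define K where "K = max 0 ((l 0 - c) / r)"
    define f where "f = Bcontfun (\<lambda>y. - K * dist x y)"
    have f: "apply_bcontfun f = (\<lambda>y. - K * dist x y)"
      unfolding f_def by (intro apply_Bcontfun cpt continuous_intros)
    have "l f \<le> c"
    proof (rule is_tropical_density_least[OF b])
      fix y
      show "ereal (f y) + b y \<le> ereal c"
      proof (cases "dist x y < r")
        case True
        then have "b y < ereal c" using r(2) by auto
        moreover have "f y \<le> 0" by (simp add: f K_def)
        ultimately show ?thesis by (cases "b y") auto
      next
        case False
        have "l 0 - c \<le> K * r"
          using r(1) by (simp add: K_def max_def divide_le_eq le_divide_eq)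
        also have "\<dots> \<le> K * dist x y"
          using False by (intro mult_left_mono) (auto simp: K_def)
        finally have "f y \<le> c - l 0" by (simp add: f)
        moreover have "b y \<le> ereal (l 0)"
          using is_tropical_density_upper[OF b, of 0 y] by (simp flip: zero_ereal_def)
        ultimately show ?thesis by (cases "b y") auto
      qed
    qed
    moreover have "(INF f. ereal (l f - apply_bcontfun f x)) \<le> ereal (l f - f x)"
      by (rule INF_lower) simp
    moreover have "f x = 0" by (simp add: f)
    ultimately have "(INF f. ereal (l f - apply_bcontfun f x)) \<le> ereal c"
      by (simp add: order_trans[of _ "ereal (l f)"])
    then show False using c(2) by simp
  qed
qed

lemma is_tropical_density_unique:
  assumes cpt: "compact (UNIV :: 'a::metric_space set)"
    and "is_tropical_density l (b :: 'a \<Rightarrow> ereal)" "is_tropical_density l c"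
  shows "b = c"
  by (rule ext) (simp only: is_tropical_density_conjugate[OF cpt assms(2)] is_tropical_density_conjugate[OF cpt assms(3)])

lemma tropical_linear_mono:
  fixes f g :: "'a::topological_space \<Rightarrow>\<^sub>C real"
  assumes "tropical_linear l" "\<And>x. f x \<le> g x"
  shows "l f \<le> l g"
proof -
  have "trop_sum_bcontfun f g = g"
    using assms(2) by (intro bcontfun_eqI) (simp add: max_def)
  then have "l g = max (l f) (l g)"
    using assms(1) unfolding tropical_linear_def by metis
  then show ?thesis by simp
qed

text \<open>The conjugate is a density. If the supremum were below \<open>l f\<close>, then around every point some \<open>h\<close> with
  \<open>l h < l f\<close> would exceed \<open>f\<close>; by compactness finitely many of them have a maximum above \<open>f\<close>, against
  monotonicity.\<close>

lemma tropical_linear_density: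
  fixes l :: "('a::metric_space \<Rightarrow>\<^sub>C real) \<Rightarrow> real"
  assumes cpt: "compact (UNIV :: 'a set)" and l: "tropical_linear l"
  shows "is_tropical_density l (\<lambda>x. INF f. ereal (l f - apply_bcontfun f x))"
proof -
  define b where "b x = (INF f. ereal (l f - apply_bcontfun f x))" for x
  have b_le: "b x \<le> ereal (l f - apply_bcontfun f x)" for f x
    unfolding b_def by (rule INF_lower) simp
  have "b x \<noteq> \<infinity>" for x
    using b_le[of x 0] by auto
  moreover have "upper_semicontinuous b"
    unfolding upper_semicontinuous_def
  proof
    fix c
    have "{x. b x < ereal c} = (\<Union>f. {x. l f - apply_bcontfun f x < c})"
      by (auto simp: b_def INF_less_iff)
    also have "open \<dots>"
      by (intro open_UN ballI open_Collect_less continuous_intros) auto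
    finally show "open {x. b x < ereal c}" .
  qed
  ultimately have "b \<in> D_max" by (simp add: D_max_def)
  moreover have "ereal (l f) = (SUP x. ereal (f x) + b x)" for f :: "'a \<Rightarrow>\<^sub>C real"
  proof (rule antisym)
    show "(SUP x. ereal (f x) + b x) \<le> ereal (l f)"
    proof (rule SUP_least)
      fix x show "ereal (f x) + b x \<le> ereal (l f)"
        using b_le[of x f] by (cases "b x") auto
    qed
    show "ereal (l f) \<le> (SUP x. ereal (f x) + b x)"
    proof (rule ccontr)
      assume "\<not> ?thesis"
      then have "(SUP x. ereal (f x) + b x) < ereal (l f)" by simp
      from ereal_dense2[OF this]
      obtain c where c: "(SUP x. ereal (f x) + b x) < ereal c" "c < l f"
        by auto
      have "\<exists>h. f x < apply_bcontfun h x \<and> l h < l f" for x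
      proof -
        have "ereal (f x) + b x < ereal c"
          using c(1) by (meson SUP_lessD UNIV_I)
        then have "b x < ereal (c - f x)" by (cases "b x") auto
        then obtain g where g: "l g - apply_bcontfun g x < c - f x"
          by (auto simp: b_def INF_less_iff)
        define t where "t = f x - g x + (l f - c)"
        have "l (const_bcontfun t + g) < l f"
          using l g by (simp add: tropical_linear_def t_def)
        moreover have "f x < (const_bcontfun t + g) x"
          using c(2) by (simp add: t_def)
        ultimately show ?thesis by blast
      qed
      then obtain h where h: "\<And>x. f x < apply_bcontfun (h x) x" "\<And>x. l (h x) < l f"
        by metis
      obtain F where F: "finite F" "(UNIV :: 'a set) \<subseteq> (\<Union>x\<in>F. {y. f y < h x y})"
      proof (rule compactE_image[OF cpt, of UNIV "\<lambda>x. {y. f y < h x y}"])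
        show "open {y. f y < h x y}" for x
          by (intro open_Collect_less) auto
      qed (use h(1) in auto)
      have "F \<noteq> {}" using F(2) by auto
      have "\<exists>H. l H < l f \<and> (\<forall>x\<in>F. \<forall>y. h x y \<le> apply_bcontfun H y)"
        using F(1) \<open>F \<noteq> {}\<close>
      proof (induction F rule: finite_ne_induct)
        case (singleton x)
        then show ?case using h(2) by auto
      next
        case (insert x F)
        then obtain H where "l H < l f" "\<forall>x\<in>F. \<forall>y. h x y \<le> apply_bcontfun H y" by blast
        then show ?case
          using h(2)[of x] l
          by (intro exI[of _ "trop_sum_bcontfun (h x) H"]) (auto simp: tropical_linear_def le_max_iff_disj)
      qed
      then obtain H where H: "l H < l f" "\<And>x y. x \<in> F \<Longrightarrow> h x y \<le> apply_bcontfun H y" by blast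
      have "f y \<le> H y" for y
      proof -
        obtain x where "x \<in> F" "f y < h x y" using F(2) by auto
        then show ?thesis using H(2)[of x y] by linarith
      qed
      from tropical_linear_mono[OF l this] H(1) show False by simp
    qed
  qed
  ultimately show ?thesis
    unfolding is_tropical_density_iff b_def[symmetric] by simp
qed

lemma tropical_linear_ex1_density:
  fixes l :: "('a::metric_space \<Rightarrow>\<^sub>C real) \<Rightarrow> real"
  assumes "compact (UNIV :: 'a set)" "tropical_linear l"
  shows "\<exists>!b. is_tropical_density l b"
  using tropical_linear_density[OF assms] is_tropical_density_unique[OF assms(1)] by blast

lemma D_max_add_continuous:
  assumes b: "b \<in> D_max" and g: "continuous_on UNIV g"
  shows "(\<lambda>x. b x + ereal (g x)) \<in> D_max"
proof (cases "b = (\<lambda>x. \<infinity>)")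
  case True
  then show ?thesis by (simp add: D_max_def)
next
  case False
  then have b': "\<And>x. b x \<noteq> \<infinity>" "\<And>c. open {x. b x < ereal c}"
    using b by (auto simp: D_max_def upper_semicontinuous_def)
  have "open {x. b x + ereal (g x) < ereal c}" for c
  proof -
    (* a real t strictly between b x and c - g x decouples the two conditions *)
    have "{x. b x + ereal (g x) < ereal c} = (\<Union>t. {x. b x < ereal t} \<inter> {x. t + g x < c})"
    proof (intro equalityI subsetI)
      fix x assume "x \<in> {x. b x + ereal (g x) < ereal c}"
      then have "b x < ereal (c - g x)" by (cases "b x") auto
      then obtain t where "b x < ereal t" "ereal t < ereal (c - g x)"
        using ereal_dense2 by blast
      then show "x \<in> (\<Union>t. {x. b x < ereal t} \<inter> {x. t + g x < c})" by auto
    next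
      fix x assume "x \<in> (\<Union>t. {x. b x < ereal t} \<inter> {x. t + g x < c})"
      then obtain t where "b x < ereal t" "t + g x < c" by auto
      then show "x \<in> {x. b x + ereal (g x) < ereal c}" by (cases "b x") auto
    qed
    also have "open \<dots>"
      by (intro open_UN ballI open_Int b' open_Collect_less continuous_intros g)
    finally show ?thesis .
  qed
  then show ?thesis
    using b'(1) by (auto simp: D_max_def upper_semicontinuous_def)
qed

lemma D_max_compose:
  assumes b: "b \<in> D_max" and T: "continuous_on UNIV T"
  shows "(\<lambda>x. b (T x)) \<in> D_max"
proof -
  have "open {x. b (T x) < c}" if "open {y. b y < c}" for c
    using open_vimage[OF that T] by (simp add: vimage_def)
  then show ?thesis using b by (auto simp: D_max_def upper_semicontinuous_def)
qed

lemma is_tropical_density_add_const: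
  assumes b: "is_tropical_density l b"
  shows "is_tropical_density (\<lambda>f. l f + k) (\<lambda>x. b x + ereal k)"
proof -
  have "ereal (l f + k) = (SUP x. ereal (apply_bcontfun f x) + (b x + ereal k))" for f
  proof -
    have "ereal (l f) = (SUP x. ereal (f x) + b x)"
      using b by (simp add: is_tropical_density_iff)
    then have "ereal (l f + k) = (SUP x. ereal (f x) + b x) + ereal k"
      by (metis plus_ereal.simps(1))
    also have "\<dots> = (SUP x. ereal (f x) + b x + ereal k)"
      by (rule SUP_ereal_add_left[symmetric]) auto
    finally show ?thesis by (simp add: add.assoc)
  qed
  then show ?thesis
    using b D_max_add_continuous[of b "\<lambda>x. k"] by (auto simp: is_tropical_density_iff)
qed

lemma is_tropical_density_shift:
  assumes b: "is_tropical_density l b"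
  shows "is_tropical_density (\<lambda>f. l (f + V)) (\<lambda>x. b x + ereal (V x))"
proof -
  have "ereal (r + V x) + b x = ereal r + (b x + ereal (V x))" for r x
    by (cases "b x") auto
  then show ?thesis
    using b D_max_add_continuous[OF _ continuous_on_apply_bcontfun, of b V]
    by (simp add: is_tropical_density_iff)
qed

lemma tropical_linear_shift:
  assumes "tropical_linear l"
  shows "tropical_linear (\<lambda>f. l (f + V))"
proof -
  have "trop_sum_bcontfun f g + V = trop_sum_bcontfun (f + V) (g + V)" for f g
    by (rule bcontfun_eqI) (simp add: max_add_distrib_left)
  then show ?thesis
    using assms by (simp add: tropical_linear_def add.assoc)
qed

context contracting_fibres
begin

text \<open>Duality: taking the supremum first over \<open>x\<close> and then over the fibre of \<open>x\<close> is taking it over the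
  whole space.\<close>

lemma is_tropical_density_bousch:
  assumes b: "is_tropical_density l b" and A: "continuous_on UNIV A"
  shows "is_tropical_density (\<lambda>f. l (Bcontfun (bousch A (apply_bcontfun f)))) (tropical_adjoint T A b)"
proof -
  have adj: "tropical_adjoint T A b = (\<lambda>x. b (T x) + ereal (A x))"
    by (simp add: fun_eq_iff tropical_adjoint_def trop_mult_ereal_right)
  have D: "tropical_adjoint T A b \<in> D_max"
    unfolding adj using b D_max_add_continuous[OF D_max_compose[OF _ continuous_map] A]
    by (simp add: is_tropical_density_def)
  have "ereal (l (Bcontfun (bousch A f))) = (SUP x. ereal (apply_bcontfun f x) + tropical_adjoint T A b x)" for f :: "'a \<Rightarrow>\<^sub>C real"
  proof -
    have L: "apply_bcontfun (Bcontfun (bousch A f)) = bousch A f"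
      by (intro apply_Bcontfun compact_space continuous_bousch A) simp
    have eq: "ereal (f y) + (b (T y) + ereal (A y)) = ereal (f y + A y) + b (T y)" for y
      by (cases "b (T y)") auto
    have "ereal (l (Bcontfun (bousch A f))) = (SUP x. ereal (bousch A f x) + b x)"
      using b by (simp add: is_tropical_density_iff L)
    also have "\<dots> = (SUP y. ereal (f y + A y) + b (T y))"
    proof (rule antisym)
      show "(SUP x. ereal (bousch A f x) + b x) \<le> (SUP y. ereal (f y + A y) + b (T y))"
      proof (rule SUP_least)
        fix x
        have "bousch A f x \<in> (\<lambda>y. f y + A y) ` (T -` {x})"
          unfolding bousch_def using finite_fibre fibre_nonempty by (intro Max_in) auto
        then obtain y where "T y = x" "bousch A f x = f y + A y" by auto
        then show "ereal (bousch A f x) + b x \<le> (SUP y. ereal (f y + A y) + b (T y))"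
          by (intro SUP_upper2[of y]) auto
      qed
      show "(SUP y. ereal (f y + A y) + b (T y)) \<le> (SUP x. ereal (bousch A f x) + b x)"
      proof (rule SUP_least)
        fix y
        have "f y + A y \<le> bousch A f (T y)"
          unfolding bousch_def using finite_fibre by (intro Max_ge) auto
        then show "ereal (f y + A y) + b (T y) \<le> (SUP x. ereal (bousch A f x) + b x)"
          by (intro SUP_upper2[of "T y"] add_right_mono) auto
      qed
    qed
    finally show ?thesis by (simp add: adj eq)
  qed
  with D show ?thesis by (simp add: is_tropical_density_iff)
qed

lemma tropical_eigen_densityI:
  fixes \<kappa> :: real
  assumes b: "is_tropical_density l b" and A: "continuous_on UNIV A"
    and l: "\<And>f. l (Bcontfun (bousch A (apply_bcontfun f))) = l f + \<kappa>"
  shows "tropical_eigen_density T A b"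
proof -
  have "tropical_adjoint T A b = (\<lambda>x. b x + ereal \<kappa>)"
    using is_tropical_density_bousch[OF b A] is_tropical_density_add_const[OF b, of \<kappa>]
    unfolding l by (rule is_tropical_density_unique[OF compact_space])
  then have "tropical_adjoint T A b = trop_product b (\<lambda>x. ereal \<kappa>)"
    by (simp add: trop_product_def trop_mult_ereal_right)
  moreover have "b \<in> D_max" using b by (simp add: is_tropical_density_def)
  ultimately show ?thesis
    using is_tropical_density_nontrivial(2,3)[OF b] by (auto simp: tropical_eigen_density_def)
qed

end

section \<open>Zero-temperature limits\<close>

lemma normal_family_functionals:
  fixes L :: "(('a::metric_space \<Rightarrow>\<^sub>C real) \<Rightarrow> real) set"
  assumes cpt: "compact (UNIV :: 'a set)"
    and lip: "\<And>l f g. l \<in> L \<Longrightarrow> \<bar>l f - l g\<bar> \<le> dist f g"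
    and zero: "\<And>l. l \<in> L \<Longrightarrow> l 0 = 0"
  shows "normal_family L"
proof -
  obtain D :: "('a \<Rightarrow>\<^sub>C real) set" where D: "countable D" "\<And>f e. e > 0 \<Longrightarrow> \<exists>g\<in>D. dist g f < e"
    using bcontfun_countable_dense[OF cpt] by blast
  show ?thesis
  proof (rule normal_familyI[OF D])
    show "\<bar>l f\<bar> \<le> norm f" if "l \<in> L" for l f
      using lip[OF that, of f 0] zero[OF that] by simp
    fix e :: real assume "e > 0"
    moreover have "\<forall>l\<in>L. \<forall>f g. dist f g < e \<longrightarrow> \<bar>l f - l g\<bar> < e"
      using lip by (meson le_less_trans)
    ultimately show "\<exists>d>0. \<forall>l\<in>L. \<forall>f g. dist f g < d \<longrightarrow> \<bar>l f - l g\<bar> < e"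
      by blast
  qed
qed

lemma const_over_at_top:
  fixes \<beta> :: "nat \<Rightarrow> real"
  assumes "filterlim \<beta> at_top sequentially"
  shows "(\<lambda>n. c / \<beta> n) \<longlonglongrightarrow> 0"
  using tendsto_divide_0[OF tendsto_const filterlim_at_top_imp_at_infinity[OF assms]] .

text \<open>A sum of two exponentials is at most twice the larger one, an error \<open>ln 2 / \<beta>\<close> that disappears in the
  limit.\<close>

lemma tropical_linear_limit:
  fixes \<nu> :: "nat \<Rightarrow> 'a::metric_space measure"
  assumes \<nu>: "\<And>n. compact_borel_prob (\<nu> n)" and \<beta>: "\<And>n. \<beta> n > 0"
    and lim: "filterlim \<beta> at_top sequentially"
    and l: "\<And>f. (\<lambda>n. log_functional (\<beta> n) (\<nu> n) f) \<longlonglongrightarrow> l f"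
  shows "tropical_linear l"
  unfolding tropical_linear_def
proof (intro conjI allI)
  fix f g :: "'a \<Rightarrow>\<^sub>C real"
  show "l (trop_sum_bcontfun f g) = max (l f) (l g)"
  proof (rule antisym)
    have "(\<lambda>n. max (log_functional (\<beta> n) (\<nu> n) f) (log_functional (\<beta> n) (\<nu> n) g) + ln 2 / \<beta> n)
        \<longlonglongrightarrow> max (l f) (l g) + 0"
      by (intro tendsto_add tendsto_max l const_over_at_top lim)
    from LIMSEQ_le[OF l this] show "l (trop_sum_bcontfun f g) \<le> max (l f) (l g)"
      using compact_borel_prob.log_functional_max_le[OF \<nu> \<beta>] by auto
    have "l f' \<le> l (trop_sum_bcontfun f g)" if "\<And>x. apply_bcontfun f' x \<le> trop_sum_bcontfun f g x + 0" for f'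
      by (rule LIMSEQ_le[OF l l]) (use compact_borel_prob.log_functional_mono[OF \<nu> \<beta> that] in auto)
    then show "max (l f) (l g) \<le> l (trop_sum_bcontfun f g)"
      by simp
  qed
next
  fix c and f :: "'a \<Rightarrow>\<^sub>C real"
  have "(\<lambda>n. c + log_functional (\<beta> n) (\<nu> n) f) \<longlonglongrightarrow> l (const_bcontfun c + f)"
    using l[of "const_bcontfun c + f"] compact_borel_prob.log_functional_add_const[OF \<nu> \<beta>] by simp
  moreover have "(\<lambda>n. c + log_functional (\<beta> n) (\<nu> n) f) \<longlonglongrightarrow> c + l f"
    by (intro tendsto_intros l)
  ultimately show "l (const_bcontfun c + f) = c + l f"
    by (rule LIMSEQ_unique)
qed

context contracting_fibres
begin

lemma bousch_mono:
  assumes "\<And>x. f x \<le> g x + c"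
  shows "bousch A f x \<le> bousch A g x + c"
proof -
  have "f y + A y \<le> bousch A g x + c" if y: "y \<in> T -` {x}" for y
  proof -
    have "g y + A y \<le> bousch A g x"
      unfolding bousch_def using finite_fibre y by (intro Max_ge) auto
    then show ?thesis using assms[of y] by linarith
  qed
  then show ?thesis
    unfolding bousch_def[of A f] using finite_fibre fibre_nonempty by simp
qed

lemma tendsto_bousch:
  assumes "uniform_limit UNIV v w sequentially"
  shows "(\<lambda>n. bousch A (v n) x) \<longlonglongrightarrow> bousch A w x"
proof (rule LIMSEQ_I)
  fix e :: real assume e: "e > 0"
  then have "\<forall>\<^sub>F n in sequentially. \<forall>x. dist (v n x) (w x) < e / 2"
    using uniform_limitD[OF assms, of "e / 2"] by simp
  then obtain n0 where n0: "\<And>n x. n \<ge> n0 \<Longrightarrow> \<bar>v n x - w x\<bar> < e / 2"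
    by (auto simp: eventually_sequentially dist_real_def)
  have "norm (bousch A (v n) x - bousch A w x) < e" if "n \<ge> n0" for n
  proof -
    have "v n y \<le> w y + e / 2" "w y \<le> v n y + e / 2" for y
      using n0[OF that, of y] by linarith+
    then have "bousch A (v n) x \<le> bousch A w x + e / 2" "bousch A w x \<le> bousch A (v n) x + e / 2"
      by (blast intro: bousch_mono)+
    with e show ?thesis by (simp add: abs_less_iff)
  qed
  then show "\<exists>no. \<forall>n\<ge>no. norm (bousch A (v n) x - bousch A w x) < e" by blast
qed

text \<open>The error \<open>ln N / \<beta>\<close> between soft maximum and maximum vanishes, and the bounded \<open>p n\<close> can be assumed
  to converge; their limit is the tropical eigenvalue.\<close>

lemma tropical_eigenfunction_limit:
  assumes v: "\<And>n. scaled_eigen A (\<beta> n) (v n) (p n)" and \<beta>: "\<And>n. \<beta> n > 0"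
    and lim: "filterlim \<beta> at_top sequentially" and p: "bounded (range p)"
    and w: "uniform_limit UNIV v w sequentially"
  shows "tropical_eigenfunction T A w"
proof -
  obtain \<kappa> r where r: "strict_mono (r :: nat \<Rightarrow> nat)" and \<kappa>: "(p \<circ> r) \<longlonglongrightarrow> \<kappa>"
    using bounded_imp_convergent_subsequence[OF p] by metis
  have wr: "uniform_limit UNIV (\<lambda>n. v (r n)) w sequentially"
    using filterlim_compose[OF w filterlim_subseq[OF r]] by simp
  have vw: "(\<lambda>n. v (r n) x) \<longlonglongrightarrow> w x" for x
    using tendsto_uniform_limitI[OF wr] by simp
  have lr: "filterlim (\<lambda>n. \<beta> (r n)) at_top sequentially"
    using filterlim_compose[OF lim filterlim_subseq[OF r]] .
  have eq: "bousch A w x = w x + \<kappa>" for x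
  proof (rule antisym)
    have R: "(\<lambda>n. v (r n) x + p (r n)) \<longlonglongrightarrow> w x + \<kappa>"
      using \<kappa> by (intro tendsto_add vw) (simp add: o_def)
    show "bousch A w x \<le> w x + \<kappa>"
      by (rule LIMSEQ_le[OF tendsto_bousch[OF wr] R]) (use scaled_eigen_bousch(1)[OF v \<beta>] in auto)
    have "(\<lambda>n. bousch A (v (r n)) x + ln (real N) / \<beta> (r n)) \<longlonglongrightarrow> bousch A w x + 0"
      by (intro tendsto_add tendsto_bousch wr const_over_at_top lr)
    from LIMSEQ_le[OF R this] show "w x + \<kappa> \<le> bousch A w x"
      using scaled_eigen_bousch(2)[OF v \<beta>] by auto
  qed
  have "continuous_on UNIV w"
    by (rule uniform_limit_theorem[OF _ w]) (use v in \<open>auto simp: scaled_eigen_def\<close>)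
  moreover have "bousch_operator T A (\<lambda>x. ereal (w x)) = trop_product (\<lambda>x. ereal (w x)) (\<lambda>x. ereal \<kappa>)"
    by (rule ext) (simp add: bousch_operator_ereal eq trop_product_def trop_mult_def)
  ultimately show ?thesis unfolding tropical_eigenfunction_def by blast
qed

end

text \<open>Logarithms at inverse temperature \<open>\<beta>\<close> grow linearly in \<open>\<beta>\<close>; dividing by \<open>\<beta>\<close> makes them comparable.\<close>

locale ruelle_family = contracting_fibres T lam \<xi> N
  for T :: "'a::metric_space \<Rightarrow> 'a" and lam \<xi> N +
  fixes A :: "'a \<Rightarrow> real" and \<alpha> C :: real and m :: "real \<Rightarrow> 'a measure" and u :: "real \<Rightarrow> 'a \<Rightarrow> real"
  assumes alpha_pos: "\<alpha> > 0" and C_nonneg: "C \<ge> 0"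
    and Holder: "\<And>x y. \<bar>A x - A y\<bar> \<le> C * dist x y powr \<alpha>"
    and eigenmeasure: "\<And>\<beta>. \<beta> > 0 \<Longrightarrow> ruelle_eigenmeasure T (\<lambda>x. \<beta> * A x) (m \<beta>)"
    and eigenfunction: "\<And>\<beta>. \<beta> > 0 \<Longrightarrow> ruelle_eigenfunction T (\<lambda>x. \<beta> * A x) (m \<beta>) (u \<beta>)"
begin

definition scaled_log :: "real \<Rightarrow> 'a \<Rightarrow> real" where
  "scaled_log \<beta> x = 1 / \<beta> * ln (u \<beta> x)"

definition scaled_pressure :: "real \<Rightarrow> real" where
  "scaled_pressure \<beta> = real_of_ereal (topological_pressure T (\<lambda>x. \<beta> * A x)) / \<beta>"

lemma scaled_eigen_scaled_log: "\<beta> > 0 \<Longrightarrow> scaled_eigen A \<beta> (scaled_log \<beta>) (scaled_pressure \<beta>)"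
  using scaled_eigen_ln[OF eigenfunction] by (simp add: scaled_log_def[abs_def] scaled_pressure_def)

lemma continuous_scaled_log: "\<beta> > 0 \<Longrightarrow> continuous_on UNIV (scaled_log \<beta>)"
  using scaled_eigen_scaled_log by (simp add: scaled_eigen_def)

lemma continuous_A: "continuous_on UNIV A"
proof -
  have "(A \<longlongrightarrow> A x) (at x)" for x
  proof -
    have "((\<lambda>y. C * dist y x powr \<alpha>) \<longlongrightarrow> C * dist x x powr \<alpha>) (at x)"
      using alpha_pos by (intro tendsto_intros) (auto intro!: eventuallyI)
    then have "((\<lambda>y. C * dist y x powr \<alpha>) \<longlongrightarrow> 0) (at x)" by simp
    then have "((\<lambda>y. A y - A x) \<longlongrightarrow> 0) (at x)"
      by (rule Lim_null_comparison[rotated]) (use Holder in \<open>auto intro!: eventuallyI\<close>)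
    then show ?thesis by (simp add: LIM_zero_iff)
  qed
  then show ?thesis by (simp add: continuous_on_def)
qed

lemma bounded_A: obtains B where "\<And>x. \<bar>A x\<bar> \<le> B"
  using compact_imp_bounded[OF compact_continuous_image[OF continuous_A compact_space]]
  by (auto simp: bounded_iff)

lemma bounded_scaled_pressure:
  assumes "\<And>n. \<beta> n > 1"
  shows "bounded (range (\<lambda>n. scaled_pressure (\<beta> n)))"
proof -
  obtain B where B: "\<And>x. \<bar>A x\<bar> \<le> B" using bounded_A by blast
  have "\<bar>scaled_pressure (\<beta> n)\<bar> \<le> ln (real N) + B" for n
    using scaled_eigen_pressure_bound[OF scaled_eigen_scaled_log _ B] assms[of n] by simp
  then show ?thesis by (auto simp: bounded_iff)
qed

lemma compact_borel_prob_m: "\<beta> > 0 \<Longrightarrow> compact_borel_prob (m \<beta>)"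
  using eigenmeasure[of \<beta>] compact_space
  by (auto simp: ruelle_eigenmeasure_def compact_borel_prob_def compact_borel_prob_axioms_def)

lemma log_functional_equilibrium:
  assumes \<beta>: "\<beta> > 0"
  shows "log_functional \<beta> (equilibrium_measure (m \<beta>) (u \<beta>)) f
    = log_functional \<beta> (m \<beta>) (f + Bcontfun (scaled_log \<beta>))"
proof -
  have "continuous_on UNIV (u \<beta>)" "\<And>x. u \<beta> x > 0"
    using eigenfunction[OF \<beta>] by (auto simp: ruelle_eigenfunction_def)
  from compact_borel_prob.log_functional_density[OF compact_borel_prob_m[OF \<beta>] \<beta> this]
  show ?thesis by (simp add: equilibrium_measure_def scaled_log_def[abs_def])
qed

text \<open>The normalisation of \<open>u \<beta>\<close> fixes the additive constant in \<open>scaled_log \<beta>\<close>.\<close>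

lemma log_functional_scaled_log:
  assumes \<beta>: "\<beta> > 0"
  shows "log_functional \<beta> (m \<beta>) (Bcontfun (scaled_log \<beta>)) = 0"
proof -
  have u: "\<And>x. u \<beta> x > 0" "(\<integral>x. u \<beta> x \<partial>m \<beta>) = 1"
    using eigenfunction[OF \<beta>] by (auto simp: ruelle_eigenfunction_def)
  have "exp (\<beta> * scaled_log \<beta> x) = u \<beta> x" for x
    using u(1)[of x] \<beta> by (simp add: scaled_log_def)
  then show ?thesis
    using u(2) apply_Bcontfun[OF compact_space continuous_scaled_log[OF \<beta>]]
    by (simp add: log_functional_def)
qed

text \<open>By the normalisation \<open>0\<close> lies between the extreme values of \<open>scaled_log \<beta>\<close>, so its oscillation
  bounds it.\<close>

lemma scaled_log_bounded:
  obtains R where "\<And>\<beta> x. \<beta> > 1 \<Longrightarrow> \<bar>scaled_log \<beta> x\<bar> \<le> R"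
proof -
  obtain B where B: "\<And>x. \<bar>A x\<bar> \<le> B" using bounded_A by blast
  obtain R where R: "\<And>\<beta> v p x x'. \<beta> \<ge> 1 \<Longrightarrow> scaled_eigen A \<beta> v p \<Longrightarrow> v x' - v x \<le> R"
    using scaled_eigen_oscillation[OF alpha_pos Holder C_nonneg B] by blast
  have "\<bar>scaled_log \<beta> x\<bar> \<le> R" if "\<beta> > 1" for \<beta> x
  proof -
    have \<beta>: "\<beta> > 0" using that by simp
    interpret compact_borel_prob "m \<beta>" using compact_borel_prob_m[OF \<beta>] .
    have osc: "scaled_log \<beta> y - scaled_log \<beta> y' \<le> R" for y y'
      using R[OF _ scaled_eigen_scaled_log[OF \<beta>]] that by simp
    let ?V = "Bcontfun (scaled_log \<beta>)"
    have V: "apply_bcontfun ?V = scaled_log \<beta>"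
      using apply_Bcontfun[OF compact_space continuous_scaled_log[OF \<beta>]] .
    have const: "log_functional \<beta> (m \<beta>) (const_bcontfun c) = c" for c
      using log_functional_add_const[OF \<beta>, of c 0] by (simp add: log_functional_0)
    have "scaled_log \<beta> x \<le> R"
      using log_functional_mono[OF \<beta>, of "const_bcontfun (scaled_log \<beta> x)" ?V R] osc[of x]
      by (simp add: V const log_functional_scaled_log[OF \<beta>] algebra_simps)
    moreover have "- scaled_log \<beta> x \<le> R"
      using log_functional_mono[OF \<beta>, of ?V "const_bcontfun (scaled_log \<beta> x)" R] osc[of _ x]
      by (simp add: V const log_functional_scaled_log[OF \<beta>] algebra_simps)
    ultimately show ?thesis by linarith
  qed
  then show thesis using that by blast
qed

lemma normal_scaled_log: "normal_family (scaled_log ` {1<..})"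
proof -
  obtain D :: "'a set" where D: "countable D" "\<And>x e. e > 0 \<Longrightarrow> \<exists>s\<in>D. dist s x < e"
    using compact_countable_dense[OF compact_space] by blast
  obtain R where R: "\<And>\<beta> x. \<beta> > 1 \<Longrightarrow> \<bar>scaled_log \<beta> x\<bar> \<le> R"
    using scaled_log_bounded by blast
  show ?thesis
  proof (rule normal_familyI[OF D])
    show "\<bar>f x\<bar> \<le> R" if "f \<in> scaled_log ` {1<..}" for f x
      using that R by auto
    fix e :: real assume "e > 0"
    then obtain d where d: "d > 0"
      "\<And>\<beta> v p x y. \<lbrakk>\<beta> \<ge> 1; scaled_eigen A \<beta> v p; dist x y < d\<rbrakk> \<Longrightarrow> \<bar>v x - v y\<bar> < e"
      using scaled_eigen_equicontinuous[OF alpha_pos Holder C_nonneg] by metis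
    have "\<bar>scaled_log \<beta> x - scaled_log \<beta> y\<bar> < e" if "\<beta> > 1" "dist x y < d" for \<beta> x y
      using d(2)[OF _ scaled_eigen_scaled_log that(2)] that(1) by simp
    with d(1) show "\<exists>d>0. \<forall>f\<in>scaled_log ` {1<..}. \<forall>x y. dist x y < d \<longrightarrow> \<bar>f x - f y\<bar> < e"
      by auto
  qed
qed

lemma normal_log_functional: "normal_family ((\<lambda>\<beta>. log_functional \<beta> (m \<beta>)) ` {1<..})"
proof (rule normal_family_functionals[OF compact_space])
  fix l assume "l \<in> (\<lambda>\<beta>. log_functional \<beta> (m \<beta>)) ` {1<..}"
  then obtain \<beta> where "\<beta> > 1" and l: "l = log_functional \<beta> (m \<beta>)" by auto
  then have \<beta>: "\<beta> > 0" by simp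
  interpret compact_borel_prob "m \<beta>" using compact_borel_prob_m[OF \<beta>] .
  show "\<bar>l f - l g\<bar> \<le> dist f g" for f g
    using log_functional_lipschitz[OF \<beta>] l by simp
  show "l 0 = 0" using log_functional_0 l by simp
qed

lemma normal_log_functional_equilibrium:
  "normal_family ((\<lambda>\<beta>. log_functional \<beta> (equilibrium_measure (m \<beta>) (u \<beta>))) ` {1<..})"
proof (rule normal_family_functionals[OF compact_space])
  fix l assume "l \<in> (\<lambda>\<beta>. log_functional \<beta> (equilibrium_measure (m \<beta>) (u \<beta>))) ` {1<..}"
  then obtain \<beta> where "\<beta> > 1" and l: "l = log_functional \<beta> (equilibrium_measure (m \<beta>) (u \<beta>))" by auto
  then have \<beta>: "\<beta> > 0" by simp
  interpret compact_borel_prob "m \<beta>" using compact_borel_prob_m[OF \<beta>] .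
  show "\<bar>l f - l g\<bar> \<le> dist f g" for f g
    using log_functional_lipschitz[OF \<beta>, of "f + Bcontfun (scaled_log \<beta>)" "g + Bcontfun (scaled_log \<beta>)"]
    by (simp add: l log_functional_equilibrium[OF \<beta>])
  show "l 0 = 0"
    by (simp add: l log_functional_equilibrium[OF \<beta>] log_functional_scaled_log[OF \<beta>])
qed

lemma scaled_log_limit:
  fixes \<beta> :: "nat \<Rightarrow> real"
  assumes \<beta>: "\<And>n. \<beta> n > 1" and lim: "filterlim \<beta> at_top sequentially"
    and v: "uniform_limit UNIV (\<lambda>n. scaled_log (\<beta> n)) v sequentially"
  shows "tropical_eigenfunction T A v"
proof (rule tropical_eigenfunction_limit[OF _ _ lim bounded_scaled_pressure v])
  show pos: "\<beta> n > 0" for n using \<beta>[of n] by simp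
  show "scaled_eigen A (\<beta> n) (scaled_log (\<beta> n)) (scaled_pressure (\<beta> n))" for n
    by (rule scaled_eigen_scaled_log[OF pos])
qed (rule \<beta>)

lemma log_functional_limit:
  fixes \<beta> :: "nat \<Rightarrow> real"
  assumes \<beta>: "\<And>n. \<beta> n > 1" and lim: "filterlim \<beta> at_top sequentially"
    and l: "\<And>f. (\<lambda>n. log_functional (\<beta> n) (m (\<beta> n)) f) \<longlonglongrightarrow> l f"
  shows "tropical_linear l" and "is_tropical_density l b \<Longrightarrow> tropical_eigen_density T A b"
proof -
  have pos: "\<beta> n > 0" for n using \<beta>[of n] by simp
  show "tropical_linear l"
    by (rule tropical_linear_limit[OF compact_borel_prob_m[OF pos] pos lim l])
  have "bounded (range (\<lambda>n. scaled_pressure (\<beta> n)))"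
    by (rule bounded_scaled_pressure) (rule \<beta>)
  then obtain \<kappa> r where r: "strict_mono (r :: nat \<Rightarrow> nat)"
    and \<kappa>: "((\<lambda>n. scaled_pressure (\<beta> n)) \<circ> r) \<longlonglongrightarrow> \<kappa>"
    using bounded_imp_convergent_subsequence by blast
  have lr: "(\<lambda>n. log_functional (\<beta> (r n)) (m (\<beta> (r n))) f) \<longlonglongrightarrow> l f" for f
    using filterlim_compose[OF l filterlim_subseq[OF r]] .
  have limr: "filterlim (\<lambda>n. \<beta> (r n)) at_top sequentially"
    using filterlim_compose[OF lim filterlim_subseq[OF r]] .
  have eq: "l (Bcontfun (bousch A (apply_bcontfun f))) = l f + \<kappa>" for f
  proof (rule antisym)
    note b = log_functional_bousch[OF eigenmeasure[OF pos] pos continuous_A, folded scaled_pressure_def]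
    have R: "(\<lambda>n. log_functional (\<beta> (r n)) (m (\<beta> (r n))) f + scaled_pressure (\<beta> (r n))) \<longlonglongrightarrow> l f + \<kappa>"
      using \<kappa> by (intro tendsto_add lr) (simp add: o_def)
    show "l (Bcontfun (bousch A (apply_bcontfun f))) \<le> l f + \<kappa>"
      by (rule LIMSEQ_le[OF lr R]) (use b(1) in auto)
    have "(\<lambda>n. log_functional (\<beta> (r n)) (m (\<beta> (r n))) (Bcontfun (bousch A (apply_bcontfun f)))
        + ln (real N) / \<beta> (r n)) \<longlonglongrightarrow> l (Bcontfun (bousch A (apply_bcontfun f))) + 0"
      by (intro tendsto_add lr const_over_at_top limr)
    from LIMSEQ_le[OF R this] show "l f + \<kappa> \<le> l (Bcontfun (bousch A (apply_bcontfun f)))"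
      using b(2) by auto
  qed
  show "tropical_eigen_density T A b" if b: "is_tropical_density l b"
    by (rule tropical_eigen_densityI[OF b continuous_A, where \<kappa> = \<kappa>]) (rule eq)
qed

text \<open>Along a subsequence the scaled logarithms converge uniformly to some \<open>v\<close> and the functionals of
  the eigenmeasures to some \<open>l'\<close>. Since these functionals are 1-Lipschitz, the limit for the
  equilibrium states is \<open>l f = l' (f + v)\<close>.\<close>

lemma equilibrium_limit_split:
  fixes \<beta> :: "nat \<Rightarrow> real"
  assumes \<beta>: "\<And>n. \<beta> n > 1" and lim: "filterlim \<beta> at_top sequentially"
    and l: "\<And>f. (\<lambda>n. log_functional (\<beta> n) (equilibrium_measure (m (\<beta> n)) (u (\<beta> n))) f) \<longlonglongrightarrow> l f"
  obtains v l' where "tropical_eigenfunction T A v" "tropical_linear l'"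
    "\<And>b. is_tropical_density l' b \<Longrightarrow> tropical_eigen_density T A b"
    "\<And>f. l f = l' (f + Bcontfun v)"
proof -
  have "range (\<lambda>n. scaled_log (\<beta> n)) \<subseteq> scaled_log ` {1<..}" using \<beta> by auto
  then obtain r v where r: "strict_mono (r :: nat \<Rightarrow> nat)"
    and v: "uniform_limit UNIV (\<lambda>n. scaled_log (\<beta> (r n))) v sequentially"
    using normal_scaled_log compact_space unfolding normal_family_def by meson
  have "range (\<lambda>n. log_functional (\<beta> (r n)) (m (\<beta> (r n)))) \<subseteq> (\<lambda>\<beta>. log_functional \<beta> (m \<beta>)) ` {1<..}"
    using \<beta> by auto
  then obtain s l' where s: "strict_mono (s :: nat \<Rightarrow> nat)"
    and l': "\<And>K. compact K \<Longrightarrow>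
      uniform_limit K (\<lambda>n. log_functional (\<beta> (r (s n))) (m (\<beta> (r (s n))))) l' sequentially"
    using normal_log_functional unfolding normal_family_def by meson
  define \<gamma> where "\<gamma> n = \<beta> (r (s n))" for n
  have \<gamma>: "\<gamma> n > 1" for n using \<beta> by (simp add: \<gamma>_def)
  then have pos: "\<gamma> n > 0" for n by (meson less_trans zero_less_one)
  have rs: "strict_mono (\<lambda>n. r (s n))"
    using strict_mono_o[OF r s] by (simp add: o_def)
  have lim\<gamma>: "filterlim \<gamma> at_top sequentially"
    unfolding \<gamma>_def using filterlim_compose[OF lim filterlim_subseq[OF rs]] .
  have l\<gamma>: "(\<lambda>n. log_functional (\<gamma> n) (equilibrium_measure (m (\<gamma> n)) (u (\<gamma> n))) f) \<longlonglongrightarrow> l f" for f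
    unfolding \<gamma>_def using filterlim_compose[OF l filterlim_subseq[OF rs]] .
  have v\<gamma>: "uniform_limit UNIV (\<lambda>n. scaled_log (\<gamma> n)) v sequentially"
    unfolding \<gamma>_def using filterlim_compose[OF v filterlim_subseq[OF s]] .
  have l'\<gamma>: "(\<lambda>n. log_functional (\<gamma> n) (m (\<gamma> n)) f) \<longlonglongrightarrow> l' f" for f
    unfolding \<gamma>_def by (rule tendsto_uniform_limitI[OF l'[of "{f}"]]) auto
  have ev: "tropical_eigenfunction T A v"
    by (rule scaled_log_limit[OF \<gamma> lim\<gamma> v\<gamma>])
  then have V: "apply_bcontfun (Bcontfun v) = v"
    by (intro apply_Bcontfun compact_space) (simp add: tropical_eigenfunction_def)
  have eq: "l f = l' (f + Bcontfun v)" for f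
  proof -
    let ?d = "\<lambda>n. log_functional (\<gamma> n) (m (\<gamma> n)) (f + Bcontfun (scaled_log (\<gamma> n)))
      - log_functional (\<gamma> n) (m (\<gamma> n)) (f + Bcontfun v)"
    have "?d \<longlonglongrightarrow> 0"
    proof (rule LIMSEQ_I)
      fix e :: real assume e: "e > 0"
      obtain n0 where n0: "\<And>n x. n \<ge> n0 \<Longrightarrow> dist (scaled_log (\<gamma> n) x) (v x) < e / 2"
        using uniform_limitD[OF v\<gamma>, of "e / 2"] e by (auto simp: eventually_sequentially)
      have "norm (?d n - 0) < e" if n: "n \<ge> n0" for n
      proof -
        have "apply_bcontfun (Bcontfun (scaled_log (\<gamma> n))) = scaled_log (\<gamma> n)"
          by (intro apply_Bcontfun compact_space continuous_scaled_log pos)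
        then have "dist (Bcontfun (scaled_log (\<gamma> n))) (Bcontfun v) \<le> e / 2"
          using n0[OF n] by (intro dist_bound) (simp add: V less_imp_le)
        moreover have "\<bar>?d n\<bar> \<le> dist (f + Bcontfun (scaled_log (\<gamma> n))) (f + Bcontfun v)"
          by (rule compact_borel_prob.log_functional_lipschitz[OF compact_borel_prob_m[OF pos] pos])
        ultimately show ?thesis using e by simp
      qed
      then show "\<exists>no. \<forall>n\<ge>no. norm (?d n - 0) < e" by blast
    qed
    from tendsto_add[OF this l'\<gamma>[of "f + Bcontfun v"]]
    have "(\<lambda>n. log_functional (\<gamma> n) (equilibrium_measure (m (\<gamma> n)) (u (\<gamma> n))) f) \<longlonglongrightarrow> l' (f + Bcontfun v)"
      by (simp add: log_functional_equilibrium[OF pos])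
    then show ?thesis using LIMSEQ_unique[OF l\<gamma>] by blast
  qed
  show thesis
    using that[OF ev log_functional_limit(1)[OF \<gamma> lim\<gamma> l'\<gamma>] log_functional_limit(2)[OF \<gamma> lim\<gamma> l'\<gamma>] eq] .
qed

lemma equilibrium_limit:
  fixes \<beta> :: "nat \<Rightarrow> real"
  assumes \<beta>: "\<And>n. \<beta> n > 1" and lim: "filterlim \<beta> at_top sequentially"
    and l: "\<And>f. (\<lambda>n. log_functional (\<beta> n) (equilibrium_measure (m (\<beta> n)) (u (\<beta> n))) f) \<longlonglongrightarrow> l f"
  shows "tropical_linear l"
    and "is_tropical_density l c \<Longrightarrow> \<exists>v b. tropical_eigenfunction T A v \<and> tropical_eigen_density T A b \<and>
      c = trop_product (\<lambda>x. ereal (v x)) b"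
proof -
  obtain v l' where v: "tropical_eigenfunction T A v" and l': "tropical_linear l'"
    "\<And>b. is_tropical_density l' b \<Longrightarrow> tropical_eigen_density T A b"
    and eq: "\<And>f. l f = l' (f + Bcontfun v)"
    using equilibrium_limit_split[OF \<beta> lim l] by blast
  have l_eq: "l = (\<lambda>f. l' (f + Bcontfun v))" using eq by blast
  show "tropical_linear l"
    unfolding l_eq by (rule tropical_linear_shift[OF l'(1)])
  obtain b where b: "is_tropical_density l' b"
    using tropical_linear_density[OF compact_space l'(1)] by blast
  have V: "apply_bcontfun (Bcontfun v) = v"
    using v by (intro apply_Bcontfun compact_space) (simp add: tropical_eigenfunction_def)
  have "is_tropical_density l (\<lambda>x. b x + ereal (v x))"
    using is_tropical_density_shift[OF b, of "Bcontfun v"] by (simp add: l_eq V)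
  also have "(\<lambda>x. b x + ereal (v x)) = trop_product (\<lambda>x. ereal (v x)) b"
    by (simp add: fun_eq_iff trop_product_def trop_mult_ereal_left add.commute)
  finally have d: "is_tropical_density l (trop_product (\<lambda>x. ereal (v x)) b)" .
  show "\<exists>v b. tropical_eigenfunction T A v \<and> tropical_eigen_density T A b \<and>
      c = trop_product (\<lambda>x. ereal (v x)) b" if "is_tropical_density l c"
    using is_tropical_density_unique[OF compact_space that d] v l'(2)[OF b] by blast
qed

end

theorem theorem5:
  fixes T :: "'a::metric_space \<Rightarrow> 'a"
    and A :: "'a \<Rightarrow> real"
    and \<alpha> :: real
    and m :: "real \<Rightarrow> 'a measure"
    and u :: "real \<Rightarrow> 'a \<Rightarrow> real"
  assumes "compact (UNIV :: 'a set)"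
    and "expanding_covering_map T"
    and "topologically_transitive T"
    and "0 < \<alpha>" and "\<alpha> \<le> 1"
    and "holder_continuous \<alpha> A"
    and "\<And>\<beta>. \<beta> > 0 \<Longrightarrow> ruelle_eigenmeasure T (\<lambda>x. \<beta> * A x) (m \<beta>)"
    and "\<And>\<beta>. \<beta> > 0 \<Longrightarrow> ruelle_eigenfunction T (\<lambda>x. \<beta> * A x) (m \<beta>) (u \<beta>)"
  shows
    "(normal_family ((\<lambda>\<beta> x. 1 / \<beta> * ln (u \<beta> x)) ` {1<..}) \<and>
      (\<forall>(\<beta>::nat \<Rightarrow> real) v.
         (\<forall>n. \<beta> n > 1) \<and> filterlim \<beta> at_top sequentially \<and>
         uniform_limit UNIV (\<lambda>n x. 1 / \<beta> n * ln (u (\<beta> n) x)) v sequentially \<longrightarrow>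
         tropical_eigenfunction T A v))
     \<and>
     (normal_family ((\<lambda>\<beta>. log_functional \<beta> (m \<beta>)) ` {1<..}) \<and>
      (\<forall>(\<beta>::nat \<Rightarrow> real) l.
         (\<forall>n. \<beta> n > 1) \<and> filterlim \<beta> at_top sequentially \<and>
         (\<forall>f. (\<lambda>n. log_functional (\<beta> n) (m (\<beta> n)) f) \<longlonglongrightarrow> l f) \<longrightarrow>
         tropical_linear l \<and> (\<exists>!b. is_tropical_density l b) \<and>
         (\<forall>b. is_tropical_density l b \<longrightarrow> tropical_eigen_density T A b)))
     \<and>
     (normal_family ((\<lambda>\<beta>. log_functional \<beta> (equilibrium_measure (m \<beta>) (u \<beta>))) ` {1<..}) \<and>
      (\<forall>(\<beta>::nat \<Rightarrow> real) l.
         (\<forall>n. \<beta> n > 1) \<and> filterlim \<beta> at_top sequentially \<and>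
         (\<forall>f. (\<lambda>n. log_functional (\<beta> n) (equilibrium_measure (m (\<beta> n)) (u (\<beta> n))) f) \<longlonglongrightarrow> l f) \<longrightarrow>
         tropical_linear l \<and> (\<exists>!b. is_tropical_density l b) \<and>
         (\<forall>c. is_tropical_density l c \<longrightarrow>
            (\<exists>v b. tropical_eigenfunction T A v \<and> tropical_eigen_density T A b \<and>
                   c = trop_product (\<lambda>x. ereal (v x)) b))))"
proof -
  obtain lam \<xi> N where "contracting_fibres T lam \<xi> N"
    using expanding_covering_map_contracting_fibres[OF assms(1-3)] .
  then interpret contracting_fibres T lam \<xi> N .
  obtain C where C: "\<And>x y. \<bar>A x - A y\<bar> \<le> C * dist x y powr \<alpha>"
    using assms(6) by (auto simp: holder_continuous_def)
  interpret ruelle_family T lam \<xi> N A \<alpha> "\<bar>C\<bar>" m u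
  proof
    fix x y :: 'a
    have "C * dist x y powr \<alpha> \<le> \<bar>C\<bar> * dist x y powr \<alpha>"
      by (intro mult_right_mono) auto
    with C[of x y] show "\<bar>A x - A y\<bar> \<le> \<bar>C\<bar> * dist x y powr \<alpha>" by linarith
  qed (use assms(4,7,8) in auto)
  show ?thesis
  proof (intro conjI allI impI; (elim conjE)?)
    show "normal_family ((\<lambda>\<beta> x. 1 / \<beta> * ln (u \<beta> x)) ` {1<..})"
      using normal_scaled_log by (simp add: scaled_log_def[abs_def])
    show "normal_family ((\<lambda>\<beta>. log_functional \<beta> (m \<beta>)) ` {1<..})"
      by (rule normal_log_functional)
    show "normal_family ((\<lambda>\<beta>. log_functional \<beta> (equilibrium_measure (m \<beta>) (u \<beta>))) ` {1<..})"
      by (rule normal_log_functional_equilibrium)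
  next
    fix \<beta> :: "nat \<Rightarrow> real" and v
    assume \<beta>: "\<forall>n. \<beta> n > 1" and lim: "filterlim \<beta> at_top sequentially"
      and v: "uniform_limit UNIV (\<lambda>n x. 1 / \<beta> n * ln (u (\<beta> n) x)) v sequentially"
    show "tropical_eigenfunction T A v"
      by (rule scaled_log_limit[OF \<beta>[rule_format] lim]) (use v in \<open>simp add: scaled_log_def[abs_def]\<close>)
  next
    fix \<beta> :: "nat \<Rightarrow> real" and l
    assume \<beta>: "\<forall>n. \<beta> n > 1" and lim: "filterlim \<beta> at_top sequentially"
      and l: "\<forall>f. (\<lambda>n. log_functional (\<beta> n) (m (\<beta> n)) f) \<longlonglongrightarrow> l f"
    note limit = log_functional_limit[OF \<beta>[rule_format] lim l[rule_format]]
    show "tropical_linear l" by (rule limit(1))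
    then show "\<exists>!b. is_tropical_density l b" by (rule tropical_linear_ex1_density[OF compact_space])
    show "tropical_eigen_density T A b" if "is_tropical_density l b" for b
      using that by (rule limit(2))
  next
    fix \<beta> :: "nat \<Rightarrow> real" and l
    assume \<beta>: "\<forall>n. \<beta> n > 1" and lim: "filterlim \<beta> at_top sequentially"
      and l: "\<forall>f. (\<lambda>n. log_functional (\<beta> n) (equilibrium_measure (m (\<beta> n)) (u (\<beta> n))) f) \<longlonglongrightarrow> l f"
    note limit = equilibrium_limit[OF \<beta>[rule_format] lim l[rule_format]]
    show "tropical_linear l" by (rule limit(1))
    then show "\<exists>!b. is_tropical_density l b" by (rule tropical_linear_ex1_density[OF compact_space])
    show "\<exists>v b. tropical_eigenfunction T A v \<and> tropical_eigen_density T A b \<and>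
        c = trop_product (\<lambda>x. ereal (v x)) b" if "is_tropical_density l c" for c
      using that by (rule limit(2))
  qed
qed

end
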